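(* Suppose that $\lim_{n\to\infty}\sqrt n(1-\lambda^{(n)})=\beta$ for some constant $\beta>0$ and $\lim_{n\to\infty}\sqrt n\left|N_j^{(n)}/n-\gamma_j\right|=0$ for every $j\in[M]$. Then there exist positive constants $C_1,C_2,C_3$ such that for all sufficiently large $n$: $$\mathbb E\big[|Y^{(n)}_{j,1}(\infty)|\big]<C_1n^{-1/2}\quad\text{for all }1\le j\le M-1,$$ $$\mathbb E\big[|Y^{(n)}_{M,1}(\infty)|\big]\le C_2,\qquad \mathbb E\big[|Y^{(n)}_{1,2}(\infty)|\big]\le C_3.$$ Furthermore, for any $a\in(1/2,1)$ there exists a constant $C_4(a)$ such that for all sufficiently large $n$ $$\mathbb E\big[|Y^{(n)}_{j,i}(\infty)|\big]\le C_4(a)\,n^{-(a-1/2)}\quad\text{for all }2\le j\le M,\ i=2,\ \text{ and for all }1\le j\le M,\ i\ge3.$$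
   Context: System: $M\ge 2$ server types (pools) with speeds $\mu_1>\mu_2>\dots>\mu_M>0$ and constants $\gamma_j>0$ with $\sum_{j=1}^M\mu_j\gamma_j=1$; $[M]=\{1,\dots,M\}$. The $n$th system has $n$ parallel servers, $N_j^{(n)}$ of type $j$, $\sum_{j=1}^M N_j^{(n)}=n$. Each server has its own queue of infinite buffer and serves jobs First-Come-First-Served. Jobs arrive according to a Poisson process of rate $n\lambda^{(n)}$ with $\lambda^{(n)}<1$; the service time of a job at a type-$j$ server is exponential with rate $\mu_j$, independently of everything else. Each job is irrevocably assigned upon arrival to a server by the Speed-Aware Join-the-Shortest-Queue (SA-JSQ) policy: it joins a server with the minimum queue length (number of jobs at that server) among all servers; ties between servers of different types are broken in favour of the type with the largest speed, and ties between servers of the same type are broken uniformly at random. $Q^{(n)}_{j,i}(t)$, $i\ge1$, denotes the number of type-$j$ servers with at least $i$ jobs at time $t$ in the $n$th system; $(Q^{(n)}_{j,i})_{j,i}$ is a Markov chain. Scaled process: $Y^{(n)}_{j,1}(t)=(Q^{(n)}_{j,1}(t)-N_j^{(n)})/\sqrt n$ and $Y^{(n)}_{j,i}(t)=Q^{(n)}_{j,i}(t)/\sqrt n$ for $i\ge2$. The Markov chain under SA-JSQ is known to be stable (positive recurrent), and $Y^{(n)}_{j,i}(\infty)$ denotes the corresponding coordinate of a random element following the stationary distribution of $\mathbf Y^{(n)}=(Y^{(n)}_{j,i})_{j\in[M],i\ge1}$. *)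

theory Defs
  imports "HOL-Probability.Probability"
begin

text \<open>A transition function \<open>P\<close> (\<open>P t x\<close> is the law at time \<open>t\<close> of the chain started in \<open>x\<close>) of a
  continuous-time Markov chain with generator (Q-matrix) \<open>q\<close>, diagonal entries included.  When \<open>q\<close> is
  conservative with bounded exit rates, as below, there is exactly one such \<open>P\<close> on times \<open>t \<ge> 0\<close>.\<close>

definition ctmc_transition :: "('s \<Rightarrow> 's \<Rightarrow> real) \<Rightarrow> (real \<Rightarrow> 's \<Rightarrow> 's pmf) \<Rightarrow> bool" where
  "ctmc_transition q P \<longleftrightarrow>
     (\<forall>x. P 0 x = return_pmf x) \<and>
     (\<forall>s\<ge>0. \<forall>t\<ge>0. \<forall>x. P (s + t) x = bind_pmf (P s x) (P t)) \<and>
     (\<forall>x y. ((\<lambda>t. pmf (P t x) y) has_real_derivative q x y) (at 0 within {0..}))"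

text \<open>A server is a pair \<open>(j, k)\<close>: the \<open>k\<close>-th server of pool \<open>j\<close>.  A configuration assigns to each
  server its queue length, the job in service included.  Types are numbered \<open>1, \<dots>, M\<close>.\<close>

type_synonym server = "nat \<times> nat"
type_synonym config = "server \<Rightarrow> nat"

definition servers :: "nat \<Rightarrow> (nat \<Rightarrow> nat) \<Rightarrow> server set" where
  "servers M N = (SIGMA j:{1..M}. {..<N j})"

definition shortest :: "nat \<Rightarrow> (nat \<Rightarrow> nat) \<Rightarrow> config \<Rightarrow> server set" where
  "shortest M N x = {s \<in> servers M N. \<forall>r\<in>servers M N. x s \<le> x r}"

definition sa_jsq_targets :: "nat \<Rightarrow> (nat \<Rightarrow> real) \<Rightarrow> (nat \<Rightarrow> nat) \<Rightarrow> config \<Rightarrow> server set" where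
  "sa_jsq_targets M \<mu> N x =
     {s \<in> shortest M N x. \<forall>r\<in>shortest M N x. \<mu> (fst r) \<le> \<mu> (fst s)}"

definition sa_jsq_prob :: "nat \<Rightarrow> (nat \<Rightarrow> real) \<Rightarrow> (nat \<Rightarrow> nat) \<Rightarrow> config \<Rightarrow> server \<Rightarrow> real" where
  "sa_jsq_prob M \<mu> N x s =
     (if s \<in> sa_jsq_targets M \<mu> N x then 1 / real (card (sa_jsq_targets M \<mu> N x)) else 0)"

text \<open>Generator of the queue lengths with total arrival rate \<open>\<Lambda>\<close>.  Every possible transition
  contributes its rate to the entry of the new configuration and, negatively, to the diagonal.\<close>

definition sa_jsq_generator ::
  "nat \<Rightarrow> (nat \<Rightarrow> real) \<Rightarrow> (nat \<Rightarrow> nat) \<Rightarrow> real \<Rightarrow> config \<Rightarrow> config \<Rightarrow> real" where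
  "sa_jsq_generator M \<mu> N \<Lambda> x y =
     (\<Sum>s\<in>servers M N.
        \<Lambda> * sa_jsq_prob M \<mu> N x s * (of_bool (y = x(s := x s + 1)) - of_bool (y = x)) +
        (if x s > 0 then \<mu> (fst s) * (of_bool (y = x(s := x s - 1)) - of_bool (y = x)) else 0))"

definition occupancy :: "(nat \<Rightarrow> nat) \<Rightarrow> config \<Rightarrow> nat \<Rightarrow> nat \<Rightarrow> nat" where
  "occupancy N x j i = card {k. k < N j \<and> i \<le> x (j, k)}"

definition scaled :: "nat \<Rightarrow> (nat \<Rightarrow> nat) \<Rightarrow> config \<Rightarrow> nat \<Rightarrow> nat \<Rightarrow> real" where
  "scaled n N x j i =
     (if i = 1 then (real (occupancy N x j i) - real (N j)) / sqrt (real n)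
      else real (occupancy N x j i) / sqrt (real n))"

text \<open>\<open>\<eta>\<close> is a stationary distribution of the scaled process \<open>Y\<close> of the \<open>n\<close>-th system with load \<open>l\<close>:
  for some initial law \<open>p\<close> of the queue lengths, \<open>Y(t)\<close> has law \<open>\<eta>\<close> at every time \<open>t \<ge> 0\<close>.  Servers
  within a pool are exchangeable, so the law of \<open>Y(t)\<close> depends on \<open>p\<close> only through the law of \<open>Y(0)\<close>;
  hence this is invariance of \<open>\<eta>\<close> under the transition function of the Markov chain \<open>Y\<close>.\<close>

definition stationary_dist_Y ::
  "nat \<Rightarrow> nat \<Rightarrow> (nat \<Rightarrow> real) \<Rightarrow> (nat \<Rightarrow> nat) \<Rightarrow> real \<Rightarrow> (nat \<Rightarrow> nat \<Rightarrow> real) pmf \<Rightarrow> bool" where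
  "stationary_dist_Y n M \<mu> N l \<eta> \<longleftrightarrow>
     (\<exists>P p. ctmc_transition (sa_jsq_generator M \<mu> N (real n * l)) P \<and>
        (\<forall>t\<ge>0. map_pmf (scaled n N) (bind_pmf p (P t)) = \<eta>))"

end

theory Submission
  imports Defs
begin

text \<open>In equilibrium the generator of the chain integrates to zero against every bounded function of the
occupancies, and the whole theorem follows from a few well-chosen functions.  Let \<open>I\<close> be the number
of idle servers, \<open>W\<close> the number of servers with at least two jobs, \<open>R = W - I\<close>, \<open>\<Lambda> = n \<lambda>\<close> the arrival
rate and \<open>c = (\<Sum>j. \<mu>\<^sub>j N\<^sub>j) - \<Lambda>\<close> the spare capacity.  The two limits in the hypotheses give
\<open>c / \<surd>n \<longlonglongrightarrow> \<beta>\<close> and \<open>N\<^sub>j / n \<longlonglongrightarrow> \<gamma>\<^sub>j\<close>.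

Level balance (lemma \<open>level_balance\<close>): the servers with more than \<open>i\<close> jobs have mean total speed
\<open>\<Lambda>\<close> times the probability that every server has at least \<open>i\<close> jobs.  For \<open>i = 0\<close> the mean total speed
of the idle servers is \<open>c\<close>, so \<open>I\<close> has mean \<open>O(\<surd>n)\<close>.

Idle servers (\<open>gen_idle_sq\<close>): while \<open>I > 0\<close> every arrival fills an idle server, and \<open>I\<close> drifts at
rate \<open>c\<close> minus the speeds of the idle servers and of the \<open>W\<close> servers with a waiting job.  The test
functions \<open>I\<^sup>2\<close> and \<open>I\<^sup>2 W\<close> give \<open>E[I W] = O(n)\<close> and \<open>E[I W\<^sup>2] = O(\<surd>n E[I W] + n E[W])\<close>.

Waiting jobs (\<open>gen_excess\<close>, \<open>E_excess\<close>): \<open>R\<close> drifts at rate \<open>-c\<close>, up to three corrections.  Idle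
servers raise the drift, which the previous step controls.  Servers with three or more jobs raise it
too, since their departures leave \<open>R\<close> unchanged, and nothing is known yet about the third level.  But
arrivals leave \<open>R\<close> unchanged exactly when every server has at least two jobs, and by level balance these two
corrections have the same mean.  The lost arrivals occur only at the maximal value \<open>R = n\<close>, so a test
function \<open>\<phi>(R)\<close> whose derivative is largest at \<open>n\<close> weighs them at least as much as the departures
from the third level, and both can be dropped.  With \<open>\<phi>(r) = r\<^sup>2\<close> this gives \<open>E[W] = O(\<surd>n)\<close>, and with
\<open>\<phi>(r) = max(r,0)\<^sup>3\<close> it gives \<open>E[max(R,0)\<^sup>2] = O(n)\<close>.

Upper levels (\<open>E_third_level\<close>, \<open>E_slow_waiting\<close>): a job can start a queue at a slow server, or become
the third job anywhere, only when there is no idle server and the fastest pool is exhausted at level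
two; then \<open>R \<ge> N\<^sub>1\<close>.  By Chebyshev's inequality this has probability \<open>O(1/n)\<close>, so such arrivals
occur at rate \<open>O(1)\<close>, and so the corresponding numbers of servers have mean \<open>O(1)\<close>.

Idle servers outside the slowest pool (\<open>E_fast_idle\<close>): while there is one, every arrival goes to such a
server, and the speed of these pools falls short of \<open>\<Lambda>\<close> by about \<open>\<mu>\<^sub>M \<gamma>\<^sub>M n\<close>.  A quadratic test function
gives mean \<open>O(1)\<close>.

Division by \<open>\<surd>n\<close> gives all claims.  The last family is of order \<open>n\<^sup>-\<^sup>1\<^sup>/\<^sup>2\<close>, hence of order
\<open>n\<^sup>-\<^sup>(\<^sup>a\<^sup>-\<^sup>1\<^sup>/\<^sup>2\<^sup>)\<close> for every \<open>a < 1\<close>.\<close>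

section \<open>Stationarity and the generator\<close>

lemma integrable_pmf_bounded:
  fixes f :: "'a \<Rightarrow> real"
  assumes "\<And>x. \<bar>f x\<bar> \<le> b"
  shows "integrable (measure_pmf p) f"
  by (rule measure_pmf.integrable_const_bound[where B = b]) (use assms in auto)

lemma expectation_bind_pmf_bounded:
  fixes f :: "'a \<Rightarrow> real"
  assumes "\<And>x. \<bar>f x\<bar> \<le> b"
  shows "measure_pmf.expectation (bind_pmf p K) f
    = measure_pmf.expectation p (\<lambda>x. measure_pmf.expectation (K x) f)"
  unfolding measure_pmf_bind
  by (rule integral_bind[where K = "count_space UNIV" and B' = 1 and B = b])
    (use assms in \<open>auto intro: measure_pmf.emeasure_le_1
      simp: measure_pmf.finite_measure_axioms measure_pmf_in_subprob_algebra\<close>)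

text \<open>The semigroup property gives \<open>P\<^sub>t(x,x) \<ge> P\<^bsub>t/k\<^esub>(x,x)\<^sup>k\<close>, Bernoulli's inequality bounds the right-hand
side by \<open>1 - k (1 - P\<^bsub>t/k\<^esub>(x,x))\<close>, and \<open>k\<close> tends to infinity.  The bound is valid for all \<open>t\<close> and
not just asymptotically, which makes it usable for domination.\<close>

lemma ctmc_holding_prob:
  assumes P: "ctmc_transition q P" and t: "0 \<le> t"
  shows "1 - pmf (P t x) x \<le> - q x x * t"
proof (cases "t = 0")
  case True
  then show ?thesis using P by (simp add: ctmc_transition_def)
next
  case False
  with t have t: "t > 0" by simp
  have P0: "P 0 x = return_pmf x" and
    semigroup: "\<And>s t. 0 \<le> s \<Longrightarrow> 0 \<le> t \<Longrightarrow> P (s + t) x = bind_pmf (P s x) (P t)" and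
    deriv: "((\<lambda>t. pmf (P t x) x) has_real_derivative q x x) (at 0 within {0..})"
    using P by (auto simp: ctmc_transition_def)
  have super: "pmf (P s x) x * pmf (P t x) x \<le> pmf (P (s + t) x) x"
    if "0 \<le> s" "0 \<le> t" for s t
  proof -
    have "pmf (P s x) x * pmf (P t x) x
        = measure_pmf.expectation (P s x) (\<lambda>z. indicator {x} z * pmf (P t x) x)"
      by (simp add: measure_pmf_single)
    also have "\<dots> \<le> measure_pmf.expectation (P s x) (\<lambda>z. pmf (P t z) x)"
      by (intro integral_mono integrable_pmf_bounded[where b = 1])
        (auto simp: pmf_le_1 indicator_def)
    finally show ?thesis using semigroup[OF that] by (simp add: pmf_bind)
  qed
  have pow: "pmf (P s x) x ^ k \<le> pmf (P (real k * s) x) x" if "0 \<le> s" for s k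
  proof (induction k)
    case 0
    then show ?case using P0 by simp
  next
    case (Suc k)
    have "pmf (P s x) x ^ Suc k \<le> pmf (P s x) x * pmf (P (real k * s) x) x"
      using Suc by (simp add: mult_left_mono)
    also have "\<dots> \<le> pmf (P (s + real k * s) x) x" using super that by simp
    finally show ?case by (simp add: algebra_simps)
  qed
  have bernoulli: "1 - pmf (P t x) x \<le> real k * (1 - pmf (P (t / real k) x) x)" if "k > 0" for k
  proof -
    let ?h = "1 - pmf (P (t / real k) x) x"
    have "1 - real k * ?h \<le> (1 - ?h) ^ k"
      using Bernoulli_inequality[of "- ?h" k] pmf_le_1[of "P (t / real k) x" x]
      by (simp add: right_diff_distrib)
    also have "\<dots> \<le> pmf (P t x) x" using pow[of "t / real k" k] that t by simp
    finally show ?thesis by simp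
  qed
  have "((\<lambda>s. (pmf (P s x) x - 1) / s) \<longlongrightarrow> q x x) (at 0 within {0..})"
    using deriv P0 by (simp add: has_field_derivative_iff)
  moreover have "filterlim (\<lambda>k. t / real (Suc k)) (at 0 within {0..}) sequentially"
    unfolding filterlim_at
  proof (intro conjI)
    show "(\<lambda>k. t / real (Suc k)) \<longlonglongrightarrow> 0"
      using tendsto_mult[OF tendsto_const[of t] LIMSEQ_inverse_real_of_nat]
      by (simp add: divide_inverse)
  qed (use t in auto)
  ultimately have "(\<lambda>k. (pmf (P (t / real (Suc k)) x) x - 1) / (t / real (Suc k))) \<longlonglongrightarrow> q x x"
    by (rule filterlim_compose)
  from tendsto_mult[OF tendsto_const[of "- t"] this]
  have "(\<lambda>k. - t * ((pmf (P (t / real (Suc k)) x) x - 1) / (t / real (Suc k)))) \<longlonglongrightarrow> - t * q x x" .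
  moreover have eq: "- t * ((u - 1) / (t / real (Suc k))) = real (Suc k) * (1 - u)" for u k
    using t by (simp add: field_simps)
  ultimately have "(\<lambda>k. real (Suc k) * (1 - pmf (P (t / real (Suc k)) x) x)) \<longlonglongrightarrow> - t * q x x"
    by (simp only: eq)
  then show ?thesis
    using Lim_bounded2[where N = 0 and C = "1 - pmf (P t x) x"] bernoulli[of "Suc k" for k]
    by (simp add: mult.commute)
qed

lemma ctmc_increment_bound:
  fixes f :: "'a \<Rightarrow> real"
  assumes P: "ctmc_transition q P" and t: "0 \<le> t" and f: "\<And>x. \<bar>f x\<bar> \<le> b"
  shows "\<bar>measure_pmf.expectation (P t x) f - f x\<bar> \<le> 2 * b * (- q x x * t)"
proof -
  have b: "0 \<le> b" using f[of x] by linarith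
  have int: "integrable (measure_pmf (P t x)) f" by (rule integrable_pmf_bounded[OF f])
  have "measure_pmf.expectation (P t x) f - f x
      = measure_pmf.expectation (P t x) (\<lambda>y. f y - f x)"
    using int by simp
  also have "\<bar>\<dots>\<bar> \<le> measure_pmf.expectation (P t x) (\<lambda>y. \<bar>f y - f x\<bar>)"
    by (rule integral_abs_bound)
  also have "\<dots> \<le> measure_pmf.expectation (P t x) (\<lambda>y. 2 * b * (1 - indicator {x} y))"
  proof (intro integral_mono)
    show "integrable (measure_pmf (P t x)) (\<lambda>y. \<bar>f y - f x\<bar>)" using int by simp
    show "integrable (measure_pmf (P t x)) (\<lambda>y. 2 * b * (1 - indicator {x} y))"
      by (rule integrable_pmf_bounded[where b = "2 * b"]) (use b in \<open>auto simp: indicator_def\<close>)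
    show "\<bar>f y - f x\<bar> \<le> 2 * b * (1 - indicator {x} y)" for y
      using f[of x] f[of y] by (auto simp: indicator_def)
  qed
  also have "\<dots> = 2 * b * (1 - pmf (P t x) x)"
    by (simp add: measure_pmf_single measure_pmf.emeasure_eq_measure)
  also have "\<dots> \<le> 2 * b * (- q x x * t)"
    using b ctmc_holding_prob[OF P t, of x] by (intro mult_left_mono) auto
  finally show ?thesis .
qed

text \<open>Pointwise differentiability controls finitely many target states.  Since the row of \<open>q\<close> sums to zero
over the finite set \<open>S\<close>, the mass outside \<open>S\<close> is \<open>o(t)\<close>, and a bounded \<open>f\<close> cannot see it.\<close>

lemma ctmc_generator_limit:
  fixes f :: "'a \<Rightarrow> real"
  assumes P: "ctmc_transition q P" and f: "\<And>x. \<bar>f x\<bar> \<le> b"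
    and fin: "finite S" "x \<in> S" and conservative: "(\<Sum>y\<in>S. q x y) = 0"
  shows "((\<lambda>t. (measure_pmf.expectation (P t x) f - f x) / t) \<longlongrightarrow> (\<Sum>y\<in>S. q x y * f y))
    (at 0 within {0..})"
proof -
  let ?F = "at (0::real) within {0..}"
  let ?D = "\<lambda>t y. (pmf (P t x) y - of_bool (y = x)) / t"
  let ?R = "\<lambda>t. measure_pmf.expectation (P t x) (\<lambda>y. f y * indicator (- S) y)"
  have P0: "P 0 x = return_pmf x"
    using P by (simp add: ctmc_transition_def)
  have D: "((\<lambda>t. ?D t y) \<longlongrightarrow> q x y) ?F" for y
  proof -
    have "((\<lambda>t. pmf (P t x) y) has_real_derivative q x y) ?F"
      using P by (simp add: ctmc_transition_def)
    then show ?thesis by (simp add: has_field_derivative_iff P0 indicator_def of_bool_def eq_commute[of x])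
  qed
  have out: "measure_pmf.prob (P t x) (- S) = 1 - (\<Sum>y\<in>S. pmf (P t x) y)" for t
    using measure_pmf.prob_compl[of S "P t x"] fin by (simp add: measure_measure_pmf_finite Compl_eq_Diff_UNIV)
  have R: "((\<lambda>t. ?R t / t) \<longlongrightarrow> 0) ?F"
  proof (rule tendsto_rabs_zero_cancel, rule tendsto_sandwich[where f = "\<lambda>_. 0"])
    have b: "0 \<le> b" using f[of x] by linarith
    have "\<bar>?R t / t\<bar> \<le> - b * (\<Sum>y\<in>S. ?D t y)" if "t > 0" for t
    proof -
      have "\<bar>?R t\<bar> \<le> measure_pmf.expectation (P t x) (\<lambda>y. \<bar>f y * indicator (- S) y\<bar>)"
        by (rule integral_abs_bound)
      also have "\<dots> \<le> measure_pmf.expectation (P t x) (\<lambda>y. b * indicator (- S) y)"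
        by (intro integral_mono integrable_pmf_bounded[where b = b])
          (use f b in \<open>auto simp: indicator_def\<close>)
      also have "\<dots> = b * (1 - (\<Sum>y\<in>S. pmf (P t x) y))"
        using out by simp
      also have "1 - (\<Sum>y\<in>S. pmf (P t x) y) = - t * (\<Sum>y\<in>S. ?D t y)"
        using fin that by (simp add: sum_subtractf flip: sum_divide_distrib)
      finally show ?thesis using that by (simp add: field_simps)
    qed
    then show "\<forall>\<^sub>F t in ?F. \<bar>?R t / t\<bar> \<le> - b * (\<Sum>y\<in>S. ?D t y)"
      by (auto simp: eventually_at_filter intro!: always_eventually)
    show "((\<lambda>t. - b * (\<Sum>y\<in>S. ?D t y)) \<longlongrightarrow> 0) ?F"
      using tendsto_mult[OF tendsto_const[of "- b"] tendsto_sum[of S "\<lambda>y t. ?D t y", OF D]]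
      by (simp add: conservative)
  qed simp_all
  have decomp: "measure_pmf.expectation (P t x) f = (\<Sum>y\<in>S. pmf (P t x) y * f y) + ?R t" for t
  proof -
    have "measure_pmf.expectation (P t x) f
      = measure_pmf.expectation (P t x) (\<lambda>y. (\<Sum>z\<in>S. f z * indicator {z} y) + f y * indicator (- S) y)"
      by (rule Bochner_Integration.integral_cong)
        (use fin in \<open>auto simp: indicator_def\<close>)
    also have "\<dots> = measure_pmf.expectation (P t x) (\<lambda>y. \<Sum>z\<in>S. f z * indicator {z} y) + ?R t"
      by (intro Bochner_Integration.integral_add Bochner_Integration.integrable_sum
          integrable_pmf_bounded[where b = b])
        (use f in \<open>auto simp: indicator_def intro: order_trans[OF abs_ge_zero f]\<close>)
    also have "measure_pmf.expectation (P t x) (\<lambda>y. \<Sum>z\<in>S. f z * indicator {z} y)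
        = (\<Sum>y\<in>S. pmf (P t x) y * f y)"
    proof -
      have "integrable (measure_pmf (P t x)) (indicat_real {z})" for z
        by (rule integrable_pmf_bounded[where b = 1]) (simp add: indicator_def)
      then show ?thesis
        by (subst Bochner_Integration.integral_sum) (auto simp: measure_pmf_single mult.commute)
    qed
    finally show ?thesis .
  qed
  have "(measure_pmf.expectation (P t x) f - f x) / t = (\<Sum>y\<in>S. ?D t y * f y) + ?R t / t" for t
  proof -
    have "(\<Sum>y\<in>S. ?D t y * f y) = ((\<Sum>y\<in>S. pmf (P t x) y * f y) - f x) / t"
    proof -
      have "(\<Sum>y\<in>S. ?D t y * f y) = (\<Sum>y\<in>S. (pmf (P t x) y * f y - (if y = x then f y else 0)) / t)"
        by (rule sum.cong) (auto simp: left_diff_distrib diff_divide_distrib)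
      then show ?thesis
        using fin by (simp add: sum_subtractf flip: sum_divide_distrib)
    qed
    then show ?thesis by (simp add: decomp add_divide_distrib diff_divide_distrib)
  qed
  moreover have "((\<lambda>t. (\<Sum>y\<in>S. ?D t y * f y) + ?R t / t) \<longlongrightarrow> (\<Sum>y\<in>S. q x y * f y) + 0) ?F"
    by (intro tendsto_add tendsto_sum tendsto_mult tendsto_const D R)
  ultimately show ?thesis by simp
qed

text \<open>Boundedness of \<open>f\<close> and of the exit rates dominates the difference quotients, so the time derivative of
a constant expectation may be taken inside the integral.  The assumption concerns one function \<open>f\<close>
rather than the law \<open>p\<close>, because for the queue lengths only the law of the occupancies is stationary.\<close>

lemma ctmc_expectation_generator_zero:
  fixes f :: "'a \<Rightarrow> real"
  assumes P: "ctmc_transition q P" and f: "\<And>x. \<bar>f x\<bar> \<le> b"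
    and fin: "\<And>x. finite (S x)" "\<And>x. x \<in> S x" and conservative: "\<And>x. (\<Sum>y\<in>S x. q x y) = 0"
    and rate: "\<And>x. - q x x \<le> c"
    and inv: "\<And>t. 0 \<le> t \<Longrightarrow>
      measure_pmf.expectation (bind_pmf p (P t)) f = measure_pmf.expectation p f"
  shows "measure_pmf.expectation p (\<lambda>x. \<Sum>y\<in>S x. q x y * f y) = 0"
proof -
  let ?h = "\<lambda>k. 1 / real (Suc k)"
  let ?u = "\<lambda>k x. (measure_pmf.expectation (P (?h k) x) f - f x) / ?h k"
  have b: "0 \<le> b" using f[of undefined] by linarith
  have Ef: "\<bar>measure_pmf.expectation r f\<bar> \<le> b" for r
    by (rule order_trans[OF integral_abs_bound measure_pmf.integral_le_const])
      (use f in \<open>auto intro!: integrable_pmf_bounded[where b = b]\<close>)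
  have "filterlim ?h (at 0 within {0..}) sequentially"
    unfolding filterlim_at using LIMSEQ_inverse_real_of_nat by (simp add: divide_inverse)
  then have lim: "(\<lambda>k. ?u k x) \<longlonglongrightarrow> (\<Sum>y\<in>S x. q x y * f y)" for x
    by (rule filterlim_compose[OF ctmc_generator_limit[OF P f fin conservative]])
  have "(\<lambda>k. measure_pmf.expectation p (?u k)) \<longlonglongrightarrow>
      measure_pmf.expectation p (\<lambda>x. \<Sum>y\<in>S x. q x y * f y)"
  proof (rule integral_dominated_convergence[where w = "\<lambda>_. 2 * b * c"])
    have "\<bar>?u k x\<bar> \<le> 2 * b * c" for k x
    proof -
      have "\<bar>?u k x\<bar> \<le> 2 * b * (- q x x * ?h k) / ?h k"
        unfolding abs_divide using ctmc_increment_bound[OF P _ f, of "?h k" x]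
        by (intro divide_mono) auto
      also have "\<dots> = 2 * b * (- q x x)" by simp
      also have "\<dots> \<le> 2 * b * c" by (intro mult_left_mono rate) (use b in auto)
      finally show ?thesis .
    qed
    then show "AE x in measure_pmf p. norm (?u k x) \<le> 2 * b * c" for k by simp
  qed (use lim in auto)
  moreover have "measure_pmf.expectation p (?u k) = 0" for k
  proof -
    have "measure_pmf.expectation p (?u k)
        = (measure_pmf.expectation (bind_pmf p (P (?h k))) f - measure_pmf.expectation p f) / ?h k"
      using f Ef by (subst expectation_bind_pmf_bounded[OF f], subst Bochner_Integration.integral_diff[symmetric])
        (auto intro!: integrable_pmf_bounded[where b = b])
    then show ?thesis using inv[of "?h k"] by simp
  qed
  ultimately show ?thesis by (simp add: LIMSEQ_const_iff)
qed

section \<open>Bounded test functions\<close>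

definition bounded_fun :: "('a \<Rightarrow> real) \<Rightarrow> bool" where
  "bounded_fun f \<longleftrightarrow> (\<exists>b. \<forall>x. \<bar>f x\<bar> \<le> b)"

lemma bounded_funI: "(\<And>x. \<bar>f x\<bar> \<le> b) \<Longrightarrow> bounded_fun f"
  by (auto simp: bounded_fun_def)

lemma bounded_fun_const [simp]: "bounded_fun (\<lambda>_. c)"
  by (rule bounded_funI[of _ "\<bar>c\<bar>"]) simp

lemma bounded_fun_add [simp]:
  assumes "bounded_fun f" "bounded_fun g" shows "bounded_fun (\<lambda>x. f x + g x)"
proof -
  obtain a b where "\<And>x. \<bar>f x\<bar> \<le> a" "\<And>x. \<bar>g x\<bar> \<le> b"
    using assms by (auto simp: bounded_fun_def)
  then show ?thesis
    by (intro bounded_funI[of _ "a + b"]) (meson abs_triangle_ineq add_mono order_trans)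
qed

lemma bounded_fun_mult [simp]:
  assumes "bounded_fun f" "bounded_fun g" shows "bounded_fun (\<lambda>x. f x * g x)"
proof -
  obtain a b where ab: "\<And>x. \<bar>f x\<bar> \<le> a" "\<And>x. \<bar>g x\<bar> \<le> b"
    using assms by (auto simp: bounded_fun_def)
  show ?thesis
    by (rule bounded_funI[of _ "a * b"]) (use ab in \<open>auto simp: abs_mult intro: mult_mono order_trans[OF abs_ge_zero]\<close>)
qed

lemma bounded_fun_power [simp]: "bounded_fun f \<Longrightarrow> bounded_fun (\<lambda>x. f x ^ k)"
  by (induction k) auto

lemma bounded_fun_uminus [simp]: "bounded_fun f \<Longrightarrow> bounded_fun (\<lambda>x. - f x)"
  using bounded_fun_mult[of "\<lambda>_. -1" f] by simp

lemma bounded_fun_diff [simp]: "bounded_fun f \<Longrightarrow> bounded_fun g \<Longrightarrow> bounded_fun (\<lambda>x. f x - g x)"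
  using bounded_fun_add[of f "\<lambda>x. - g x"] by simp

lemma bounded_fun_max [simp]: "bounded_fun f \<Longrightarrow> bounded_fun (\<lambda>x. max (f x) 0)"
  unfolding bounded_fun_def by (metis abs_ge_zero abs_zero max_def order_trans)

lemma bounded_fun_of_bool [simp]: "bounded_fun (\<lambda>x. of_bool (Q x))"
  by (rule bounded_funI[of _ 1]) simp

lemma bounded_fun_sum [simp]: "(\<And>i. i \<in> A \<Longrightarrow> bounded_fun (f i)) \<Longrightarrow> bounded_fun (\<lambda>x. \<Sum>i\<in>A. f i x)"
  by (induction A rule: infinite_finite_induct) auto

lemma bounded_fun_compose: "bounded_fun f \<Longrightarrow> bounded_fun (\<lambda>x. f (g x))"
  by (auto simp: bounded_fun_def)

lemma bounded_fun_integrable [simp]: "bounded_fun f \<Longrightarrow> integrable (measure_pmf p) f"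
  by (auto simp: bounded_fun_def intro: integrable_pmf_bounded)

section \<open>Speed-aware join-the-shortest-queue\<close>

locale sa_jsq =
  fixes M :: nat and \<mu> :: "nat \<Rightarrow> real" and N :: "nat \<Rightarrow> nat" and n :: nat and \<Lambda> :: real
  assumes M: "2 \<le> M"
    and speeds: "\<And>i j. 1 \<le> i \<Longrightarrow> i < j \<Longrightarrow> j \<le> M \<Longrightarrow> \<mu> j < \<mu> i"
    and slowest: "0 < \<mu> M"
    and size: "(\<Sum>j=1..M. N j) = n"
    and n: "1 \<le> n"
    and \<Lambda>: "0 < \<Lambda>"
begin

declare sum_of_bool_mult_eq [simp del] sum_mult_of_bool_eq [simp del] sum_of_bool_eq [simp del]

abbreviation srv :: "server set" where "srv \<equiv> servers M N"
abbreviation \<pi> :: "config \<Rightarrow> server \<Rightarrow> real" where "\<pi> \<equiv> sa_jsq_prob M \<mu> N"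
abbreviation targets :: "config \<Rightarrow> server set" where "targets \<equiv> sa_jsq_targets M \<mu> N"

lemma finite_srv [simp]: "finite srv"
  by (simp add: servers_def)

lemma srv_type: "s \<in> srv \<Longrightarrow> 1 \<le> fst s \<and> fst s \<le> M"
  by (auto simp: servers_def)

lemma sum_srv: "(\<Sum>s\<in>srv. g (fst s)) = (\<Sum>j=1..M. g j * real (N j))"
  using sum.Sigma[of "{1..M}" "\<lambda>j. {..<N j}" "\<lambda>j k. g j"]
  by (simp add: servers_def case_prod_unfold mult.commute)

lemma card_srv: "card srv = n"
  using size by (simp add: servers_def)

lemma srv_nonempty: "srv \<noteq> {}"
  using card_srv n by auto

lemma speed_bounds:
  assumes "1 \<le> j" "j \<le> M" shows "\<mu> M \<le> \<mu> j" "\<mu> j \<le> \<mu> 1" "0 < \<mu> j"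
proof -
  show a: "\<mu> M \<le> \<mu> j" using speeds[of j M] assms by (cases "j = M") auto
  show "\<mu> j \<le> \<mu> 1" using speeds[of 1 j] assms by (cases "j = 1") auto
  show "0 < \<mu> j" using a slowest by simp
qed

lemma \<mu>_nonneg: "s \<in> srv \<Longrightarrow> 0 \<le> \<mu> (fst s)"
  using speed_bounds(3)[of "fst s"] srv_type[of s] by auto

lemma target_shortest:
  assumes "s \<in> targets x" shows "s \<in> srv" "r \<in> srv \<Longrightarrow> x s \<le> x r"
  using assms by (auto simp: sa_jsq_targets_def shortest_def)

text \<open>Both halves of the policy in one rule: a server that is at most as long as the target has the same
length, and is then no faster, so its type has no smaller index.\<close>

lemma target_fastest:
  assumes s: "s \<in> targets x" and r: "r \<in> srv" "x r \<le> x s" shows "fst s \<le> fst r"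
proof (rule ccontr)
  assume "\<not> fst s \<le> fst r"
  then have "\<mu> (fst s) < \<mu> (fst r)"
    using speeds[of "fst r" "fst s"] srv_type[OF r(1)] srv_type[OF target_shortest(1)[OF s]] by auto
  moreover have "r \<in> shortest M N x"
    using r target_shortest[OF s] by (auto simp: shortest_def) (metis order_trans surj_pair)
  then have "\<mu> (fst r) \<le> \<mu> (fst s)"
    using s by (auto simp: sa_jsq_targets_def)
  ultimately show False by simp
qed

lemma targets_nonempty: "targets x \<noteq> {}"
proof -
  have "Min (x ` srv) \<in> x ` srv" using srv_nonempty by (intro Min_in) auto
  then obtain s where "s \<in> srv" "x s = Min (x ` srv)" by auto
  then have "s \<in> shortest M N x" by (auto simp: shortest_def)
  moreover have fin: "finite (shortest M N x)" by (simp add: shortest_def)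
  ultimately have "Max ((\<lambda>s. \<mu> (fst s)) ` shortest M N x) \<in> (\<lambda>s. \<mu> (fst s)) ` shortest M N x"
    by (intro Max_in) auto
  then obtain t where t: "t \<in> shortest M N x" "\<mu> (fst t) = Max ((\<lambda>s. \<mu> (fst s)) ` shortest M N x)"
    by auto
  have "\<mu> (fst r) \<le> \<mu> (fst t)" if "r \<in> shortest M N x" for r
    unfolding t(2) by (rule Max_ge) (use fin that in auto)
  with t(1) have "t \<in> targets x" by (simp add: sa_jsq_targets_def)
  then show ?thesis by blast
qed

lemma targets_subset: "targets x \<subseteq> srv"
  using target_shortest(1) by auto

lemma \<pi>_nonneg: "0 \<le> \<pi> x s"
  by (simp add: sa_jsq_prob_def)

lemma sum_\<pi>: "(\<Sum>s\<in>srv. \<pi> x s * a s) = (\<Sum>s\<in>targets x. \<pi> x s * a s)"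
  by (rule sum.mono_neutral_right) (use targets_subset in \<open>auto simp: sa_jsq_prob_def\<close>)

lemma sum_\<pi>_1: "(\<Sum>s\<in>srv. \<pi> x s) = 1"
proof -
  have "finite (targets x)" using targets_subset finite_srv by (rule finite_subset)
  then show ?thesis
    using sum_\<pi>[of x "\<lambda>_. 1"] targets_nonempty[of x] by (simp add: sa_jsq_prob_def)
qed

text \<open>The factor \<open>of_bool (0 < x s)\<close> switches off service at an empty queue,
so the truncated subtraction there is harmless.\<close>

definition gen :: "(config \<Rightarrow> real) \<Rightarrow> config \<Rightarrow> real" where
  "gen f x = \<Lambda> * (\<Sum>s\<in>srv. \<pi> x s * (f (x(s := x s + 1)) - f x))
     + (\<Sum>s\<in>srv. of_bool (0 < x s) * \<mu> (fst s) * (f (x(s := x s - 1)) - f x))"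

text \<open>A finite set that carries the row of the generator at \<open>x\<close>.\<close>

definition reachable :: "config \<Rightarrow> config set" where
  "reachable x = insert x ((\<lambda>s. x(s := x s + 1)) ` srv \<union> (\<lambda>s. x(s := x s - 1)) ` srv)"

lemma finite_reachable: "finite (reachable x)"
  by (simp add: reachable_def)

lemma generator_sum: "(\<Sum>y\<in>reachable x. sa_jsq_generator M \<mu> N \<Lambda> x y * f y) = gen f x"
proof -
  have delta: "(\<Sum>y\<in>reachable x. (of_bool (y = u) - of_bool (y = x)) * f y) = f u - f x"
    if "u \<in> reachable x" for u
  proof -
    have "(\<Sum>y\<in>reachable x. (of_bool (y = u) - of_bool (y = x)) * f y)
        = (\<Sum>y\<in>reachable x. if y = u then f y else 0) - (\<Sum>y\<in>reachable x. if y = x then f y else 0)"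
      unfolding sum_subtractf[symmetric] by (rule sum.cong) auto
    then show ?thesis
      using that finite_reachable[of x] by (simp add: reachable_def)
  qed
  have "(\<Sum>y\<in>reachable x. sa_jsq_generator M \<mu> N \<Lambda> x y * f y)
      = (\<Sum>y\<in>reachable x. \<Sum>s\<in>srv.
          \<Lambda> * \<pi> x s * ((of_bool (y = x(s := x s + 1)) - of_bool (y = x)) * f y)
          + of_bool (0 < x s) * \<mu> (fst s) * ((of_bool (y = x(s := x s - 1)) - of_bool (y = x)) * f y))"
    unfolding sa_jsq_generator_def sum_distrib_right
    by (intro sum.cong refl) (simp add: algebra_simps)
  also have "\<dots> = (\<Sum>s\<in>srv. \<Lambda> * \<pi> x s * (f (x(s := x s + 1)) - f x)
          + of_bool (0 < x s) * \<mu> (fst s) * (f (x(s := x s - 1)) - f x))"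
    by (subst sum.swap, intro sum.cong refl, unfold sum.distrib, subst (1 2) sum_distrib_left[symmetric],
        subst (1 2) delta) (auto simp: reachable_def)
  also have "\<dots> = gen f x"
    by (simp add: gen_def sum.distrib sum_distrib_left mult.assoc)
  finally show ?thesis .
qed

lemma generator_conservative: "(\<Sum>y\<in>reachable x. sa_jsq_generator M \<mu> N \<Lambda> x y) = 0"
  using generator_sum[of x "\<lambda>_. 1"] by (simp add: gen_def)

definition cap :: real where "cap = (\<Sum>s\<in>srv. \<mu> (fst s))"

lemma exit_rate: "- sa_jsq_generator M \<mu> N \<Lambda> x x \<le> \<Lambda> + cap"
proof -
  have ne: "x \<noteq> x(s := v)" if "v \<noteq> x s" for s v
    using that by (metis fun_upd_same)
  have "- sa_jsq_generator M \<mu> N \<Lambda> x x = (\<Sum>s\<in>srv. \<Lambda> * \<pi> x s + (if 0 < x s then \<mu> (fst s) else 0))"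
    unfolding sa_jsq_generator_def sum_negf[symmetric]
  proof (rule sum.cong)
    fix s
    have "x \<noteq> x(s := x s + 1)" "0 < x s \<Longrightarrow> x \<noteq> x(s := x s - 1)"
      using ne[of "x s + 1" s] ne[of "x s - 1" s] by simp_all
    then show "- (\<Lambda> * \<pi> x s * (of_bool (x = x(s := x s + 1)) - of_bool (x = x)) +
          (if 0 < x s then \<mu> (fst s) * (of_bool (x = x(s := x s - 1)) - of_bool (x = x)) else 0))
        = \<Lambda> * \<pi> x s + (if 0 < x s then \<mu> (fst s) else 0)"
      by simp
  qed simp
  also have "\<dots> \<le> (\<Sum>s\<in>srv. \<Lambda> * \<pi> x s + \<mu> (fst s))"
    by (intro sum_mono) (simp add: \<mu>_nonneg)
  also have "\<dots> = \<Lambda> + cap"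
    by (simp add: sum.distrib cap_def sum_\<pi>_1 flip: sum_distrib_left)
  finally show ?thesis .
qed

text \<open>Bounds on the increments suffice to bound the generator: the arrival probabilities sum to one, so only
the worst target matters.\<close>

lemma gen_le:
  assumes arrival: "\<And>s. s \<in> targets x \<Longrightarrow> f (x(s := x s + 1)) - f x \<le> a"
    and service: "\<And>s. s \<in> srv \<Longrightarrow> 0 < x s \<Longrightarrow> f (x(s := x s - 1)) - f x \<le> d s"
  shows "gen f x \<le> \<Lambda> * a + (\<Sum>s\<in>srv. of_bool (0 < x s) * \<mu> (fst s) * d s)"
proof -
  have "(\<Sum>s\<in>srv. \<pi> x s * (f (x(s := x s + 1)) - f x)) \<le> (\<Sum>s\<in>srv. \<pi> x s * a)"
    unfolding sum_\<pi> by (intro sum_mono mult_left_mono arrival \<pi>_nonneg)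
  then have "(\<Sum>s\<in>srv. \<pi> x s * (f (x(s := x s + 1)) - f x)) \<le> a"
    by (simp add: sum_\<pi>_1 flip: sum_distrib_right)
  then have "\<Lambda> * (\<Sum>s\<in>srv. \<pi> x s * (f (x(s := x s + 1)) - f x)) \<le> \<Lambda> * a"
    using \<Lambda> by (intro mult_left_mono) auto
  moreover have "of_bool (0 < x s) * \<mu> (fst s) * (f (x(s := x s - 1)) - f x)
      \<le> of_bool (0 < x s) * \<mu> (fst s) * d s" if "s \<in> srv" for s
    using service[OF that] speed_bounds(3)[of "fst s"] srv_type[OF that] by (auto intro: mult_left_mono)
  then have "(\<Sum>s\<in>srv. of_bool (0 < x s) * \<mu> (fst s) * (f (x(s := x s - 1)) - f x))
      \<le> (\<Sum>s\<in>srv. of_bool (0 < x s) * \<mu> (fst s) * d s)"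
    by (rule sum_mono)
  ultimately show ?thesis unfolding gen_def by (rule add_mono)
qed

text \<open>All test functions are built from these weighted occupancies.  With weights \<open>\<lambda>_. 1\<close> they count
servers, with weights \<open>\<mu>\<close> they give total speeds, and a weight \<open>of_bool\<close> selects pools.\<close>

definition occ :: "(nat \<Rightarrow> real) \<Rightarrow> nat \<Rightarrow> config \<Rightarrow> real" where
  "occ w i x = (\<Sum>s\<in>srv. w (fst s) * of_bool (i \<le> x s))"

lemma occ_occupancy: "occ w i x = (\<Sum>j=1..M. w j * real (occupancy N x j i))"
proof -
  have "(\<Sum>k<N j. w j * of_bool (i \<le> x (j, k))) = w j * real (occupancy N x j i)" for j
    unfolding occupancy_def sum_distrib_left[symmetric]
    by (simp add: sum_of_bool_eq Int_def)
  then show ?thesis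
    using sum.Sigma[of "{1..M}" "\<lambda>j. {..<N j}" "\<lambda>j k. w j * of_bool (i \<le> x (j, k))"]
    by (simp add: occ_def servers_def case_prod_unfold)
qed

lemma occ_arrival:
  assumes "s \<in> srv"
  shows "occ w i (x(s := x s + 1)) = occ w i x + w (fst s) * of_bool (x s + 1 = i)"
proof -
  have "(\<Sum>r\<in>srv - {s}. w (fst r) * of_bool (i \<le> (x(s := x s + 1)) r))
      = (\<Sum>r\<in>srv - {s}. w (fst r) * of_bool (i \<le> x r))"
    by (rule sum.cong) auto
  then show ?thesis
    unfolding occ_def sum.remove[OF finite_srv assms] by (auto simp: algebra_simps of_bool_def)
qed

lemma occ_service:
  assumes "s \<in> srv" "0 < x s" "1 \<le> i"
  shows "occ w i (x(s := x s - 1)) = occ w i x - w (fst s) * of_bool (x s = i)"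
proof -
  have "(\<Sum>r\<in>srv - {s}. w (fst r) * of_bool (i \<le> (x(s := x s - 1)) r))
      = (\<Sum>r\<in>srv - {s}. w (fst r) * of_bool (i \<le> x r))"
    by (rule sum.cong) auto
  then show ?thesis
    unfolding occ_def sum.remove[OF finite_srv assms(1)]
    using assms(2,3) by (auto simp: algebra_simps of_bool_def)
qed

lemma occ_diff: "i \<le> k \<Longrightarrow> occ w i x - occ w k x = (\<Sum>s\<in>srv. w (fst s) * of_bool (i \<le> x s \<and> x s < k))"
  unfolding occ_def sum_subtractf[symmetric] by (rule sum.cong) auto

lemma occ_mono: 
  assumes "\<And>s. s \<in> srv \<Longrightarrow> i \<le> x s \<Longrightarrow> v (fst s) \<le> w (fst s)"
    and "\<And>s. s \<in> srv \<Longrightarrow> 0 \<le> w (fst s)" and "k \<le> i"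
  shows "occ v i x \<le> occ w k x"
  unfolding occ_def using assms by (intro sum_mono) (auto simp: of_bool_def)

lemma occ_nonneg: "(\<And>s. s \<in> srv \<Longrightarrow> 0 \<le> w (fst s)) \<Longrightarrow> 0 \<le> occ w i x"
  unfolding occ_def by (intro sum_nonneg) auto

lemma bounded_fun_occ [simp]: "bounded_fun (occ w i)"
  unfolding occ_def by simp

lemma occ_\<mu>_nonneg: "0 \<le> occ \<mu> i x"
  using \<mu>_nonneg by (rule occ_nonneg)

definition full :: "nat \<Rightarrow> config \<Rightarrow> real" where
  "full i x = of_bool (\<forall>s\<in>srv. i \<le> x s)"

lemma bounded_fun_full [simp]: "bounded_fun (full i)"
  unfolding full_def by simp

lemma full_target: "s \<in> targets x \<Longrightarrow> full i x = of_bool (i \<le> x s)"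
  unfolding full_def using target_shortest[of s x] by (auto simp: of_bool_def) (metis order_trans surj_pair)

text \<open>The target has minimal queue length, so an arrival raises level \<open>i\<close> precisely when that minimum is \<open>i - 1\<close>,
and \<open>full (i - 1) x - full i x\<close> is the indicator of this event.\<close>

lemma gen_occ:
  assumes "1 \<le> i"
  shows "gen (occ (\<lambda>_. 1) i) x = \<Lambda> * (full (i - 1) x - full i x) - (occ \<mu> i x - occ \<mu> (i + 1) x)"
proof -
  have "(\<Sum>s\<in>srv. \<pi> x s * (occ (\<lambda>_. 1) i (x(s := x s + 1)) - occ (\<lambda>_. 1) i x))
      = (\<Sum>s\<in>targets x. \<pi> x s * (full (i - 1) x - full i x))"
    unfolding sum_\<pi>
  proof (rule sum.cong)
    fix s assume s: "s \<in> targets x"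
    have "of_bool (x s + 1 = i) = (of_bool (i - 1 \<le> x s) - of_bool (i \<le> x s) :: real)"
      using assms by (cases "x s + 1" i rule: linorder_cases) auto
    then show "\<pi> x s * (occ (\<lambda>_. 1) i (x(s := x s + 1)) - occ (\<lambda>_. 1) i x)
        = \<pi> x s * (full (i - 1) x - full i x)"
      unfolding occ_arrival[OF target_shortest(1)[OF s]] full_target[OF s] by simp
  qed simp
  also have "\<dots> = full (i - 1) x - full i x"
    using sum_\<pi>[of x "\<lambda>_. full (i - 1) x - full i x"]
    by (simp add: sum_\<pi>_1 flip: sum_distrib_right)
  finally have arr: "(\<Sum>s\<in>srv. \<pi> x s * (occ (\<lambda>_. 1) i (x(s := x s + 1)) - occ (\<lambda>_. 1) i x))
      = full (i - 1) x - full i x" .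
  have "(\<Sum>s\<in>srv. of_bool (0 < x s) * \<mu> (fst s) * (occ (\<lambda>_. 1) i (x(s := x s - 1)) - occ (\<lambda>_. 1) i x))
      = - (occ \<mu> i x - occ \<mu> (i + 1) x)"
    unfolding occ_diff[OF le_add1] sum_negf[symmetric]
    by (rule sum.cong) (use assms in \<open>auto simp: occ_service[simplified] of_bool_def\<close>)
  then show ?thesis using arr by (simp add: gen_def)
qed

text \<open>Every server with one job contributes 0 to \<open>excess\<close>, an idle one \<open>-1\<close>, any other one \<open>1\<close>: it is the
total number of jobs minus \<open>n\<close>, with queues cut off at two jobs.  The cut-off keeps it bounded, so that
no moment of the stationary law has to be known beforehand.\<close>

definition idle :: "config \<Rightarrow> real" where "idle x = real n - occ (\<lambda>_. 1) 1 x"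
definition waiting :: "config \<Rightarrow> real" where "waiting x = occ (\<lambda>_. 1) 2 x"
definition excess :: "config \<Rightarrow> real" where "excess x = waiting x - idle x"
definition idle_rate :: "config \<Rightarrow> real" where "idle_rate x = cap - occ \<mu> 1 x"
definition slack :: real where "slack = cap - \<Lambda>"

lemma bounded_fun_idle [simp]: "bounded_fun idle"
  and bounded_fun_waiting [simp]: "bounded_fun waiting"
  and bounded_fun_excess [simp]: "bounded_fun excess"
  and bounded_fun_idle_rate [simp]: "bounded_fun idle_rate"
  unfolding excess_def waiting_def idle_def idle_rate_def by simp_all

lemma occ_0: "occ w 0 x = (\<Sum>s\<in>srv. w (fst s))"
  by (simp add: occ_def)

lemma idle_eq: "idle x = (\<Sum>s\<in>srv. of_bool (x s = 0))"
  using occ_diff[of 0 1 "\<lambda>_. 1" x] by (simp add: idle_def occ_0 card_srv)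

lemma idle_rate_eq: "idle_rate x = (\<Sum>s\<in>srv. \<mu> (fst s) * of_bool (x s = 0))"
  using occ_diff[of 0 1 \<mu> x] by (simp add: idle_rate_def occ_0 cap_def)

lemma idle_nonneg: "0 \<le> idle x"
  unfolding idle_eq by (intro sum_nonneg) auto

lemma waiting_nonneg: "0 \<le> waiting x"
  unfolding waiting_def by (intro occ_nonneg) auto

lemma waiting_le: "waiting x \<le> real n"
proof -
  have "waiting x \<le> occ (\<lambda>_. 1) 0 x" unfolding waiting_def by (rule occ_mono) auto
  then show ?thesis by (simp add: occ_0 card_srv)
qed

lemma cap_nonneg: "0 \<le> cap"
  unfolding cap_def by (intro sum_nonneg \<mu>_nonneg)

lemma idle_rate_bounds: "\<mu> M * idle x \<le> idle_rate x" "idle_rate x \<le> \<mu> 1 * idle x"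
  unfolding idle_eq idle_rate_eq sum_distrib_left
  using speed_bounds srv_type by (auto intro!: sum_mono mult_right_mono)

lemma idle_rate_nonneg: "0 \<le> idle_rate x"
  unfolding idle_rate_eq by (intro sum_nonneg) (auto simp: \<mu>_nonneg)

lemma occ_\<mu>_lower: "\<mu> M * occ (\<lambda>_. 1) i x \<le> occ \<mu> i x"
  unfolding occ_def sum_distrib_left
  using speed_bounds srv_type by (auto intro!: sum_mono mult_right_mono)

lemma no_idle: "(\<And>s. s \<in> srv \<Longrightarrow> 0 < x s) \<Longrightarrow> idle x = 0"
  unfolding idle_eq by (intro sum.neutral) auto

section \<open>Drift inequalities\<close>

text \<open>An idle server receives the next arrival, so arrivals leave \<open>waiting\<close> unchanged unless \<open>idle\<close> vanishes,
and departures can only lower \<open>waiting\<close>.  Hence any monotone factor \<open>\<psi> (waiting x)\<close> can be carried along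
with the drift of the square.\<close>

lemma gen_idle_sq:
  assumes \<psi>: "\<And>u. 0 \<le> u \<Longrightarrow> 0 \<le> \<psi> u" "\<And>u v. u \<le> v \<Longrightarrow> \<psi> u \<le> \<psi> v"
  shows "gen (\<lambda>x. (idle x)\<^sup>2 * \<psi> (waiting x)) x
    \<le> \<psi> (waiting x) * (2 * idle x * (slack - idle_rate x - occ \<mu> 2 x) + (\<Lambda> + cap))"
proof -
  let ?I = "idle x" and ?W = "\<psi> (waiting x)"
  have W: "0 \<le> ?W" by (rule \<psi>(1)[OF waiting_nonneg])
  have "gen (\<lambda>x. (idle x)\<^sup>2 * \<psi> (waiting x)) x \<le> \<Lambda> * ((1 - 2 * ?I) * ?W)
      + (\<Sum>s\<in>srv. of_bool (0 < x s) * \<mu> (fst s) * ((2 * ?I + 1) * ?W * of_bool (x s = 1)))"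
  proof (rule gen_le)
    fix s assume s: "s \<in> targets x"
    note upd = occ_arrival[OF target_shortest(1)[OF s], of _ _ x]
    show "(idle (x(s := x s + 1)))\<^sup>2 * \<psi> (waiting (x(s := x s + 1))) - ?I\<^sup>2 * ?W \<le> (1 - 2 * ?I) * ?W"
    proof (cases "x s = 0")
      case True
      then have I': "idle (x(s := x s + 1)) = ?I - 1" and W': "waiting (x(s := x s + 1)) = waiting x"
        unfolding idle_def waiting_def upd by auto
      show ?thesis unfolding I' W' by (simp add: power2_eq_square algebra_simps)
    next
      case False
      then have "?I = 0" using target_shortest(2)[OF s] by (intro no_idle) fastforce
      moreover have "idle (x(s := x s + 1)) = ?I"
        using False unfolding idle_def upd by auto
      ultimately show ?thesis using W by simp
    qed
  next
    fix s assume s: "s \<in> srv" "0 < x s"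
    note upd = occ_service[of s x, OF s]
    have I': "idle (x(s := x s - 1)) = ?I + of_bool (x s = 1)"
      unfolding idle_def using upd[of 1 "\<lambda>_. 1"] by simp
    have W': "waiting (x(s := x s - 1)) = waiting x - of_bool (x s = 2)"
      unfolding waiting_def using upd[of 2 "\<lambda>_. 1"] by simp
    show "(idle (x(s := x s - 1)))\<^sup>2 * \<psi> (waiting (x(s := x s - 1))) - ?I\<^sup>2 * ?W
        \<le> (2 * ?I + 1) * ?W * of_bool (x s = 1)"
    proof (cases "x s = 1")
      case True
      then show ?thesis unfolding I' W' by (simp add: power2_eq_square algebra_simps)
    next
      case False
      have "\<psi> (waiting (x(s := x s - 1))) \<le> ?W" unfolding W' by (rule \<psi>(2)) simp
      then show ?thesis unfolding I' using False by (simp add: mult_left_mono)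
    qed
  qed
  also have "(\<Sum>s\<in>srv. of_bool (0 < x s) * \<mu> (fst s) * ((2 * ?I + 1) * ?W * of_bool (x s = 1)))
      = (2 * ?I + 1) * ?W * (occ \<mu> 1 x - occ \<mu> 2 x)"
    unfolding occ_diff[OF one_le_numeral] sum_distrib_left
    by (rule sum.cong) (auto simp: of_bool_def)
  also have "\<Lambda> * ((1 - 2 * ?I) * ?W) + (2 * ?I + 1) * ?W * (occ \<mu> 1 x - occ \<mu> 2 x)
      = ?W * (2 * ?I * (slack - idle_rate x - occ \<mu> 2 x) + (\<Lambda> + (cap - idle_rate x - occ \<mu> 2 x)))"
    by (simp add: slack_def idle_rate_def algebra_simps)
  also have "\<dots> \<le> ?W * (2 * ?I * (slack - idle_rate x - occ \<mu> 2 x) + (\<Lambda> + cap))"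
    using W idle_rate_nonneg[of x] occ_\<mu>_nonneg[of 2 x] by (intro mult_left_mono) auto
  finally show ?thesis .
qed

text \<open>Arrivals raise \<open>excess\<close> except in the states with \<open>full 2\<close>, departures lower it except at servers
with three or more jobs.  These exceptions are the terms \<open>\<Lambda> * full 2 x\<close> and \<open>occ \<mu> 3 x\<close>.  The function \<open>h\<close>
bounds the second-order error.\<close>

lemma gen_excess:
  assumes \<phi>: "\<And>r d. d \<in> {-1, 1} \<Longrightarrow> \<phi> (r + d) - \<phi> r \<le> \<phi>' r * d + h r"
    and h: "\<And>r. (0::real) \<le> h r"
  shows "gen (\<lambda>x. \<phi> (excess x)) x
    \<le> \<phi>' (excess x) * (idle_rate x - slack + occ \<mu> 3 x - \<Lambda> * full 2 x) + h (excess x) * (\<Lambda> + cap)"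
proof -
  let ?R = "excess x"
  have "gen (\<lambda>x. \<phi> (excess x)) x \<le> \<Lambda> * ((\<phi>' ?R + h ?R) * (1 - full 2 x))
      + (\<Sum>s\<in>srv. of_bool (0 < x s) * \<mu> (fst s) * ((h ?R - \<phi>' ?R) * of_bool (x s \<le> 2)))"
  proof (rule gen_le)
    fix s assume s: "s \<in> targets x"
    note upd = occ_arrival[OF target_shortest(1)[OF s], of _ _ x]
    have "excess (x(s := x s + 1)) = ?R + of_bool (x s < 2)"
      unfolding excess_def waiting_def idle_def upd by (auto simp: of_bool_def)
    then show "\<phi> (excess (x(s := x s + 1))) - \<phi> ?R \<le> (\<phi>' ?R + h ?R) * (1 - full 2 x)"
      using \<phi>[of 1 ?R] full_target[OF s, of 2] by (cases "x s < 2") auto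
  next
    fix s assume s: "s \<in> srv" "0 < x s"
    have "excess (x(s := x s - 1)) = ?R + - of_bool (x s \<le> 2)"
      unfolding excess_def waiting_def idle_def
      using occ_service[of s x 1 "\<lambda>_. 1"] occ_service[of s x 2 "\<lambda>_. 1"] s(1) s(2) by (auto simp: of_bool_def)
    then show "\<phi> (excess (x(s := x s - 1))) - \<phi> ?R \<le> (h ?R - \<phi>' ?R) * of_bool (x s \<le> 2)"
      using \<phi>[of "-1" ?R] by (cases "x s \<le> 2") auto
  qed
  also have "(\<Sum>s\<in>srv. of_bool (0 < x s) * \<mu> (fst s) * ((h ?R - \<phi>' ?R) * of_bool (x s \<le> 2)))
      = (h ?R - \<phi>' ?R) * (occ \<mu> 1 x - occ \<mu> 3 x)"
    unfolding occ_diff[OF one_le_numeral] sum_distrib_left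
    by (rule sum.cong) (auto simp: of_bool_def)
  also have "\<Lambda> * ((\<phi>' ?R + h ?R) * (1 - full 2 x)) + (h ?R - \<phi>' ?R) * (occ \<mu> 1 x - occ \<mu> 3 x)
      = \<phi>' ?R * (idle_rate x - slack + occ \<mu> 3 x - \<Lambda> * full 2 x)
        + h ?R * (\<Lambda> * (1 - full 2 x) + (cap - idle_rate x - occ \<mu> 3 x))"
    by (simp add: slack_def idle_rate_def algebra_simps)
  also have "\<dots> \<le> \<phi>' ?R * (idle_rate x - slack + occ \<mu> 3 x - \<Lambda> * full 2 x) + h ?R * (\<Lambda> + cap)"
  proof -
    have "\<Lambda> * (1 - full 2 x) \<le> \<Lambda>" using \<Lambda> by (simp add: full_def)
    then show ?thesis
      using h[of ?R] idle_rate_nonneg[of x] occ_\<mu>_nonneg[of 3 x] by (intro add_left_mono mult_left_mono) auto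
  qed
  finally show ?thesis .
qed

definition fast_idle :: "config \<Rightarrow> real" where
  "fast_idle x = occ (\<lambda>j. of_bool (j < M)) 0 x - occ (\<lambda>j. of_bool (j < M)) 1 x"

lemma bounded_fun_fast_idle [simp]: "bounded_fun fast_idle"
  unfolding fast_idle_def by simp

lemma fast_idle_eq: "fast_idle x = (\<Sum>s\<in>srv. of_bool (fst s < M) * of_bool (x s = 0))"
  unfolding fast_idle_def by (subst occ_diff) auto

lemma fast_idle_nonneg: "0 \<le> fast_idle x"
  unfolding fast_idle_eq by (intro sum_nonneg) auto

text \<open>As long as a server outside pool \<open>M\<close> is idle, arrivals only go to such servers, at rate \<open>\<Lambda>\<close>, while new ones
appear at most at the total speed \<open>cap - \<mu> M * N M\<close> of these pools.\<close>

lemma gen_fast_idle_sq: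
  "gen (\<lambda>x. (fast_idle x)\<^sup>2) x \<le> 2 * fast_idle x * (slack - \<mu> M * real (N M)) + (\<Lambda> + cap)"
proof -
  let ?W = "fast_idle x" and ?u = "\<lambda>j. of_bool (j < M) :: real"
  have W: "0 \<le> ?W" by (rule fast_idle_nonneg)
  have "gen (\<lambda>x. (fast_idle x)\<^sup>2) x \<le> \<Lambda> * (1 - 2 * ?W)
      + (\<Sum>s\<in>srv. of_bool (0 < x s) * \<mu> (fst s) * ((2 * ?W + 1) * ?u (fst s) * of_bool (x s = 1)))"
  proof (rule gen_le)
    fix s assume s: "s \<in> targets x"
    have upd: "fast_idle (x(s := x s + 1)) = ?W - ?u (fst s) * of_bool (x s = 0)"
      unfolding fast_idle_def occ_arrival[OF target_shortest(1)[OF s]] by (auto simp: of_bool_def)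
    show "(fast_idle (x(s := x s + 1)))\<^sup>2 - ?W\<^sup>2 \<le> 1 - 2 * ?W"
    proof (cases "\<exists>r\<in>srv. fst r < M \<and> x r = 0")
      case True
      then obtain r where "r \<in> srv" "fst r < M" "x r = 0" by auto
      then have "x s = 0" "fst s < M"
        using target_shortest(2)[OF s, of r] target_fastest[OF s, of r] by auto
      then show ?thesis unfolding upd by (simp add: power2_eq_square algebra_simps)
    next
      case False
      then have "?W = 0" unfolding fast_idle_eq by (intro sum.neutral) auto
      moreover have "?u (fst s) * of_bool (x s = 0) = (0::real)"
        using False target_shortest(1)[OF s] by (auto simp: of_bool_def)
      ultimately show ?thesis unfolding upd by simp
    qed
  next
    fix s assume s: "s \<in> srv" "0 < x s"
    have "fast_idle (x(s := x s - 1)) = ?W + ?u (fst s) * of_bool (x s = 1)"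
      using occ_service[of s x 1 ?u] s by (simp add: fast_idle_def occ_0)
    then show "(fast_idle (x(s := x s - 1)))\<^sup>2 - ?W\<^sup>2 \<le> (2 * ?W + 1) * ?u (fst s) * of_bool (x s = 1)"
      by (auto simp: of_bool_def power2_eq_square algebra_simps)
  qed
  also have "(\<Sum>s\<in>srv. of_bool (0 < x s) * \<mu> (fst s) * ((2 * ?W + 1) * ?u (fst s) * of_bool (x s = 1)))
      \<le> (\<Sum>s\<in>srv. (2 * ?W + 1) * (\<mu> (fst s) * ?u (fst s)))"
    using W \<mu>_nonneg by (intro sum_mono) (auto simp: of_bool_def)
  also have "\<dots> = (2 * ?W + 1) * (cap - \<mu> M * real (N M))"
  proof -
    have "(\<Sum>s\<in>srv. \<mu> (fst s) * ?u (fst s)) = (\<Sum>s\<in>srv. \<mu> (fst s) - \<mu> M * of_bool (fst s = M))"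
      by (rule sum.cong) (use srv_type in \<open>force simp: of_bool_def\<close>)+
    also have "\<dots> = cap - (\<Sum>s\<in>srv. \<mu> M * of_bool (fst s = M))"
      by (simp add: sum_subtractf cap_def)
    also have "(\<Sum>s\<in>srv. \<mu> M * of_bool (fst s = M)) = (\<Sum>j=1..M. if j = M then \<mu> M * real (N M) else 0)"
      unfolding sum_srv[of "\<lambda>j. \<mu> M * of_bool (j = M)"] by (rule sum.cong) auto
    also have "\<dots> = \<mu> M * real (N M)"
      using M by simp
    finally show ?thesis by (simp flip: sum_distrib_left)
  qed
  also have "\<Lambda> * (1 - 2 * ?W) + (2 * ?W + 1) * (cap - \<mu> M * real (N M))
      = 2 * ?W * (slack - \<mu> M * real (N M)) + (\<Lambda> + (cap - \<mu> M * real (N M)))"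
    by (simp add: slack_def algebra_simps)
  also have "\<dots> \<le> 2 * ?W * (slack - \<mu> M * real (N M)) + (\<Lambda> + cap)"
    using slowest by simp
  finally show ?thesis by simp
qed

lemma waiting_fast: 
  assumes "\<And>r. r \<in> srv \<Longrightarrow> fst r = 1 \<Longrightarrow> 2 \<le> x r"
  shows "real (N 1) \<le> waiting x"
proof -
  have "real (N 1) = (\<Sum>s\<in>srv. of_bool (fst s = 1))"
    using M sum_srv[of "\<lambda>j. of_bool (j = 1)"] by (simp add: of_bool_def if_distrib[of "\<lambda>u. u * _"] cong: if_cong)
  also have "\<dots> \<le> waiting x"
    unfolding waiting_def occ_def using assms by (intro sum_mono) (auto simp: of_bool_def)
  finally show ?thesis .
qed

text \<open>When every server has at least two jobs, none is idle and the whole of pool 1 counts as waiting.\<close>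

lemma full_2_le: "full 2 x \<le> of_bool (real (N 1) \<le> excess x)"
proof (cases "\<forall>s\<in>srv. 2 \<le> x s")
  case True
  then have "idle x = 0" by (intro no_idle) force
  moreover have "real (N 1) \<le> waiting x" using True by (intro waiting_fast) auto
  ultimately show ?thesis by (simp add: excess_def full_def)
qed (auto simp: full_def)

text \<open>A target of type at least 2 with one job has minimal queue length and is among the fastest of that
length.  So no server is idle, and every server of pool 1 has at least two jobs already.\<close>

lemma gen_slow_waiting:
  fixes v :: "nat \<Rightarrow> real"
  defines "v \<equiv> \<lambda>j. of_bool (2 \<le> j)"
  shows "gen (occ v 2) x \<le> \<Lambda> * of_bool (real (N 1) \<le> excess x)
    - (occ (\<lambda>j. \<mu> j * v j) 2 x - occ (\<lambda>j. \<mu> j * v j) 3 x)"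
proof -
  have "gen (occ v 2) x \<le> \<Lambda> * of_bool (real (N 1) \<le> excess x)
      + (\<Sum>s\<in>srv. of_bool (0 < x s) * \<mu> (fst s) * (- v (fst s) * of_bool (x s = 2)))"
  proof (rule gen_le)
    fix s assume s: "s \<in> targets x"
    have "real (N 1) \<le> excess x" if xs: "x s = 1" "2 \<le> fst s"
    proof -
      have "idle x = 0" using target_shortest(2)[OF s] xs by (intro no_idle) force
      moreover have "real (N 1) \<le> waiting x"
      proof (rule waiting_fast)
        fix r assume "r \<in> srv" "fst r = 1"
        then show "2 \<le> x r" using target_fastest[OF s, of r] xs by force
      qed
      ultimately show ?thesis by (simp add: excess_def)
    qed
    then show "occ v 2 (x(s := x s + 1)) - occ v 2 x \<le> of_bool (real (N 1) \<le> excess x)"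
      unfolding occ_arrival[OF target_shortest(1)[OF s]] by (auto simp: v_def of_bool_def)
  next
    fix s assume s: "s \<in> srv" "0 < x s"
    show "occ v 2 (x(s := x s - 1)) - occ v 2 x \<le> - v (fst s) * of_bool (x s = 2)"
      using occ_service[of s x 2 v] s by simp
  qed
  also have "(\<Sum>s\<in>srv. of_bool (0 < x s) * \<mu> (fst s) * (- v (fst s) * of_bool (x s = 2)))
      = - (occ (\<lambda>j. \<mu> j * v j) 2 x - occ (\<lambda>j. \<mu> j * v j) 3 x)"
    by (subst occ_diff, simp, unfold sum_negf[symmetric], rule sum.cong) (auto simp: of_bool_def)
  finally show ?thesis by simp
qed

section \<open>Occupancies and the scaled process\<close>

lemma occ_cong: "occupancy N x = occupancy N y \<Longrightarrow> occ w i x = occ w i y"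
  by (simp add: occ_occupancy)

lemma idle_cong: "occupancy N x = occupancy N y \<Longrightarrow> idle x = idle y"
  unfolding idle_def using occ_cong by metis

lemma waiting_cong: "occupancy N x = occupancy N y \<Longrightarrow> waiting x = waiting y"
  unfolding waiting_def by (rule occ_cong)

lemma excess_cong: "occupancy N x = occupancy N y \<Longrightarrow> excess x = excess y"
  unfolding excess_def using idle_cong waiting_cong by metis

lemma fast_idle_cong: "occupancy N x = occupancy N y \<Longrightarrow> fast_idle x = fast_idle y"
  unfolding fast_idle_def using occ_cong by metis

lemma bounded_fun_gen [simp]:
  assumes "bounded_fun f" shows "bounded_fun (gen f)"
proof -
  have "\<bar>\<pi> x s\<bar> \<le> 1" if "s \<in> srv" for x s
    using \<pi>_nonneg[of x s] member_le_sum[OF that, of "\<pi> x"] by (simp add: sum_\<pi>_1 \<pi>_nonneg)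
  then have "bounded_fun (\<lambda>x. \<pi> x s)" if "s \<in> srv" for s
    using that by (intro bounded_funI[of _ 1])
  then show ?thesis
    unfolding gen_def
    by (intro bounded_fun_add bounded_fun_mult bounded_fun_sum bounded_fun_diff bounded_fun_const
        bounded_fun_of_bool bounded_fun_compose[OF assms] assms)
qed

text \<open>Functions of the occupancies are functions of the scaled process, whose law is the one that is
stationary.\<close>

lemma occupancy_scaled:
  assumes "scaled n N x = scaled n N y" shows "occupancy N x = occupancy N y"
proof (intro ext)
  fix j i
  have "scaled n N x j i = scaled n N y j i" using assms by simp
  then show "occupancy N x j i = occupancy N y j i"
    using n by (auto simp: scaled_def split: if_splits)
qed

lemma excess_le_waiting: "excess x \<le> waiting x"
  using idle_nonneg[of x] by (simp add: excess_def)

lemma excess_le: "excess x \<le> real n"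
  using excess_le_waiting[of x] waiting_le[of x] by simp

text \<open>In the states where arrivals leave \<open>excess\<close> unchanged, it has its maximal value \<open>n\<close>.\<close>

lemma excess_full_2: "full 2 x * real n = full 2 x * excess x"
proof (cases "\<forall>s\<in>srv. 2 \<le> x s")
  case True
  then have "idle x = 0" by (intro no_idle) force
  moreover have "waiting x = real n"
    using True card_srv by (simp add: waiting_def occ_def)
  ultimately show ?thesis by (simp add: excess_def)
qed (auto simp: full_def)

lemma occupancy_le:
  assumes "1 \<le> j" "j \<le> M" "\<And>j. 0 \<le> w j" "1 \<le> w j"
  shows "real (occupancy N x j i) \<le> occ w i x"
proof -
  have "real (occupancy N x j i) \<le> w j * real (occupancy N x j i)"
    using mult_right_mono[OF assms(4), of "real (occupancy N x j i)"] by simp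
  also have "\<dots> \<le> occ w i x"
    unfolding occ_occupancy
    by (rule member_le_sum[of j "{1..M}" "\<lambda>j. w j * real (occupancy N x j i)"]) (use assms in auto)
  finally show ?thesis .
qed

lemma pool_idle:
  assumes "1 \<le> j" "j \<le> M" "\<And>j. 0 \<le> w j" "1 \<le> w j"
  shows "\<bar>real (occupancy N x j 1) - real (N j)\<bar> \<le> occ w 0 x - occ w 1 x"
proof -
  have le: "occupancy N x j 1 \<le> N j" for j
  proof -
    have "occupancy N x j 1 \<le> card {..<N j}"
      unfolding occupancy_def by (rule card_mono) auto
    then show ?thesis by simp
  qed
  have "real (N j) - real (occupancy N x j 1) \<le> w j * (real (N j) - real (occupancy N x j 1))"
    using mult_right_mono[OF assms(4), of "real (N j) - real (occupancy N x j 1)"] le[of j] by simp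
  also have "\<dots> \<le> (\<Sum>j=1..M. w j * (real (N j) - real (occupancy N x j 1)))"
    by (rule member_le_sum[of j "{1..M}" "\<lambda>j. w j * (real (N j) - real (occupancy N x j 1))"])
      (use assms le in auto)
  also have "\<dots> = occ w 0 x - occ w 1 x"
  proof -
    have "{k. k < N j} = {..<N j}" for j by auto
    then have "occupancy N x j 0 = N j" for j by (simp add: occupancy_def)
    then show ?thesis by (simp add: occ_occupancy right_diff_distrib sum_subtractf)
  qed
  finally show ?thesis using le[of j] by simp
qed

lemma scaled_bounds:
  assumes j: "1 \<le> j" "j \<le> M"
  shows "j < M \<Longrightarrow> \<bar>scaled n N x j 1\<bar> \<le> fast_idle x / sqrt (real n)"
    and "\<bar>scaled n N x j 1\<bar> \<le> idle x / sqrt (real n)"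
    and "\<bar>scaled n N x j 2\<bar> \<le> waiting x / sqrt (real n)"
    and "2 \<le> j \<Longrightarrow> \<bar>scaled n N x j 2\<bar> \<le> occ (\<lambda>j. of_bool (2 \<le> j)) 2 x / sqrt (real n)"
    and "3 \<le> i \<Longrightarrow> \<bar>scaled n N x j i\<bar> \<le> occ (\<lambda>_. 1) 3 x / sqrt (real n)"
proof -
  show "\<bar>scaled n N x j 1\<bar> \<le> fast_idle x / sqrt (real n)" if "j < M"
    using pool_idle[OF j, of "\<lambda>j. of_bool (j < M)" x] that
    by (simp add: scaled_def fast_idle_def divide_right_mono)
  show "\<bar>scaled n N x j 1\<bar> \<le> idle x / sqrt (real n)"
    using pool_idle[OF j, of "\<lambda>_. 1" x]
    by (simp add: scaled_def idle_def occ_0 card_srv divide_right_mono)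
  show "\<bar>scaled n N x j 2\<bar> \<le> waiting x / sqrt (real n)"
    using occupancy_le[OF j, of "\<lambda>_. 1" x 2]
    by (simp add: scaled_def waiting_def divide_right_mono)
  show "\<bar>scaled n N x j 2\<bar> \<le> occ (\<lambda>j. of_bool (2 \<le> j)) 2 x / sqrt (real n)" if "2 \<le> j"
    using occupancy_le[OF j, of "\<lambda>j. of_bool (2 \<le> j)" x 2] that
    by (simp add: scaled_def divide_right_mono)
  show "\<bar>scaled n N x j i\<bar> \<le> occ (\<lambda>_. 1) 3 x / sqrt (real n)" if "3 \<le> i"
  proof -
    have "occ (\<lambda>_. 1) i x \<le> occ (\<lambda>_. 1) 3 x" using that by (intro occ_mono) auto
    then have "real (occupancy N x j i) \<le> occ (\<lambda>_. 1) 3 x"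
      using occupancy_le[OF j, of "\<lambda>_. 1" x i] by simp
    then show ?thesis using that by (simp add: scaled_def divide_right_mono)
  qed
qed

end

section \<open>Moments of the stationary law\<close>

text \<open>A unit step may cross the kink at 0; the error made there is absorbed by the additive constant.\<close>

lemma cube_pos_part_increment:
  fixes r d :: real
  assumes "d \<in> {-1, 1}"
  shows "(max (r + d) 0) ^ 3 - (max r 0) ^ 3 \<le> 3 * (max r 0)\<^sup>2 * d + (3 * max r 0 + 1)"
proof -
  consider "r \<ge> 1" | "0 \<le> r" "r < 1" | "r < 0" by linarith
  then show ?thesis
  proof cases
    case 1
    then have "max (r + d) 0 = r + d" "max r 0 = r" using assms by auto
    then show ?thesis using assms by (auto simp: power2_eq_square power3_eq_cube algebra_simps)
  next
    case 2
    have "(r - 1) ^ 3 \<ge> - 1"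
      using power_mono[of "1 - r" 1 3] 2 by (simp add: power3_eq_cube algebra_simps)
    then have "- (r ^ 3) \<le> - 3 * r\<^sup>2 + 3 * r + 1"
      by (simp add: power2_eq_square power3_eq_cube algebra_simps)
    then show ?thesis using 2 assms
      by (auto simp: power2_eq_square power3_eq_cube algebra_simps max_def)
  next
    case 3
    have "(max (r + d) 0) ^ 3 \<le> 1 ^ 3" by (rule power_mono) (use 3 assms in auto)
    then show ?thesis using 3 by simp
  qed
qed

text \<open>Only the law of the scaled process is invariant, not the law \<open>p\<close> of the individual queue lengths; hence the
restriction to test functions of the occupancies in what follows.\<close>

locale sa_jsq_stationary = sa_jsq +
  fixes P :: "real \<Rightarrow> config \<Rightarrow> config pmf" and p :: "config pmf"
  assumes transition: "ctmc_transition (sa_jsq_generator M \<mu> N \<Lambda>) P"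
    and invariant: "\<And>t. 0 \<le> t \<Longrightarrow> map_pmf (scaled n N) (bind_pmf p (P t)) = map_pmf (scaled n N) p"
begin

abbreviation E :: "(config \<Rightarrow> real) \<Rightarrow> real" where "E \<equiv> measure_pmf.expectation p"

lemma E_mono: "bounded_fun f \<Longrightarrow> bounded_fun g \<Longrightarrow> (\<And>x. f x \<le> g x) \<Longrightarrow> E f \<le> E g"
  by (intro integral_mono) auto

text \<open>The existence of \<open>g\<close> with \<open>f = g \<circ> scaled n N\<close> transfers the invariance of the law of the scaled process to
the expectation of \<open>f\<close>.\<close>

lemma E_gen:
  assumes f: "bounded_fun f" and det: "\<And>x y. occupancy N x = occupancy N y \<Longrightarrow> f x = f y"
  shows "E (gen f) = 0"
proof -
  obtain b where b: "\<And>x. \<bar>f x\<bar> \<le> b" using f by (auto simp: bounded_fun_def)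
  define g where "g v = f (SOME x. scaled n N x = v)" for v
  have g: "f x = g (scaled n N x)" for x
    unfolding g_def by (rule det, rule occupancy_scaled, rule someI2[where a = x]) auto
  have "measure_pmf.expectation r f = measure_pmf.expectation (map_pmf (scaled n N) r) g" for r
    by (simp flip: g)
  then have "measure_pmf.expectation (bind_pmf p (P t)) f = E f" if "0 \<le> t" for t
    using invariant[OF that] by metis
  from ctmc_expectation_generator_zero[OF transition b finite_reachable _ generator_conservative exit_rate this]
  have "E (\<lambda>x. \<Sum>y\<in>reachable x. sa_jsq_generator M \<mu> N \<Lambda> x y * f y) = 0"
    by (simp add: reachable_def)
  then show ?thesis by (simp add: generator_sum)
qed

lemma E_gen_le:
  assumes "bounded_fun f" "\<And>x y. occupancy N x = occupancy N y \<Longrightarrow> f x = f y"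
    and "bounded_fun F" "\<And>x. gen f x \<le> F x"
  shows "0 \<le> E F"
  using E_mono[of "gen f" F] E_gen[OF assms(1,2)] assms(1,3,4) by simp

text \<open>The balance equation of level \<open>k + 1\<close> says that the difference of the two sides does not depend on the
level.  It tends to 0 by dominated convergence, because every configuration has a highest level.\<close>

lemma level_balance: "E (occ \<mu> (i + 1)) = \<Lambda> * E (full i)"
proof -
  let ?D = "\<lambda>k. E (\<lambda>x. occ \<mu> (k + 1) x - \<Lambda> * full k x)"
  have step: "?D (Suc k) = ?D k" for k
  proof -
    have "E (gen (occ (\<lambda>_. 1) (k + 1))) = 0"
      by (rule E_gen[OF _ occ_cong]) simp
    moreover have "gen (occ (\<lambda>_. 1) (k + 1))
        = (\<lambda>x. \<Lambda> * (full k x - full (k + 1) x) - (occ \<mu> (k + 1) x - occ \<mu> (k + 2) x))"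
      using gen_occ[of "k + 1"] by auto
    ultimately show ?thesis
      by (simp add: right_diff_distrib)
  qed
  have const: "?D k = ?D 0" for k
    by (induction k) (use step in auto)
  have "?D \<longlonglongrightarrow> E (\<lambda>_. 0)"
  proof (rule integral_dominated_convergence[where w = "\<lambda>_. (\<Sum>s\<in>srv. \<mu> (fst s)) + \<Lambda>"])
    show "AE x in measure_pmf p. (\<lambda>k. occ \<mu> (k + 1) x - \<Lambda> * full k x) \<longlonglongrightarrow> 0"
    proof (intro AE_I2)
      fix x
      have "occ \<mu> (k + 1) x - \<Lambda> * full k x = 0" if "Max (x ` srv) < k" for k
      proof -
        have less: "x s < k" if "s \<in> srv" for s
          using \<open>Max (x ` srv) < k\<close> that by (subst (asm) Max_less_iff) auto
        have "full k x = 0"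
          using srv_nonempty less by (fastforce simp: full_def)
        moreover have "occ \<mu> (k + 1) x = 0"
          unfolding occ_def by (intro sum.neutral ballI) (use less in \<open>fastforce simp: of_bool_def\<close>)
        ultimately show ?thesis by simp
      qed
      then show "(\<lambda>k. occ \<mu> (k + 1) x - \<Lambda> * full k x) \<longlonglongrightarrow> 0"
        by (intro tendsto_eventually) (auto simp: eventually_at_top_dense)
    qed
    show "AE x in measure_pmf p. norm (occ \<mu> (k + 1) x - \<Lambda> * full k x) \<le> (\<Sum>s\<in>srv. \<mu> (fst s)) + \<Lambda>" for k
    proof (intro AE_I2)
      fix x
      have "occ \<mu> (k + 1) x \<le> (\<Sum>s\<in>srv. \<mu> (fst s))"
        unfolding occ_def by (intro sum_mono) (auto simp: \<mu>_nonneg of_bool_def)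
      moreover have "0 \<le> full k x" "full k x \<le> 1" by (auto simp: full_def)
      then have "0 \<le> \<Lambda> * full k x" "\<Lambda> * full k x \<le> \<Lambda>" using \<Lambda> by auto
      ultimately show "norm (occ \<mu> (k + 1) x - \<Lambda> * full k x) \<le> (\<Sum>s\<in>srv. \<mu> (fst s)) + \<Lambda>"
        using occ_\<mu>_nonneg[of "k + 1" x] by simp
    qed
  qed auto
  moreover have "?D = (\<lambda>_. ?D 0)" using const by (rule ext)
  ultimately have "(\<lambda>_::nat. ?D 0) \<longlonglongrightarrow> E (\<lambda>_. 0)" by metis
  then have "?D 0 = E (\<lambda>_. 0)" by (rule LIMSEQ_const_iff[THEN iffD1])
  then have "?D 0 = 0" by simp
  then show ?thesis using const[of i] by simp
qed

lemma E_idle_rate: "E idle_rate = slack"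
proof -
  have "E (\<lambda>x. cap - occ \<mu> 1 x) = cap - \<Lambda> * E (full 0)"
    using level_balance[of 0] by simp
  also have "full 0 = (\<lambda>_. 1)" by (auto simp: full_def)
  finally show ?thesis by (simp add: idle_rate_def[abs_def] slack_def)
qed

lemma E_idle: "\<mu> M * E idle \<le> slack"
  using E_mono[of "\<lambda>x. \<mu> M * idle x" idle_rate] idle_rate_bounds(1) by (simp add: E_idle_rate)

lemma E_idle_waiting: "2 * \<mu> M * E (\<lambda>x. idle x * waiting x) \<le> 2 * slack * E idle + (\<Lambda> + cap)"
proof -
  have "0 \<le> E (\<lambda>x. 2 * slack * idle x + (\<Lambda> + cap) - 2 * \<mu> M * (idle x * waiting x))"
  proof (rule E_gen_le)
    fix x
    have "idle x * (\<mu> M * waiting x) \<le> idle x * occ \<mu> 2 x"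
      using occ_\<mu>_lower[of 2 x] idle_nonneg[of x] by (intro mult_left_mono) (auto simp: waiting_def)
    moreover have "0 \<le> idle x * idle_rate x"
      using idle_nonneg[of x] idle_rate_nonneg[of x] by simp
    ultimately show "gen (\<lambda>x. (idle x)\<^sup>2 * 1) x
        \<le> 2 * slack * idle x + (\<Lambda> + cap) - 2 * \<mu> M * (idle x * waiting x)"
      using gen_idle_sq[of "\<lambda>_. 1" x] by (simp add: algebra_simps)
  next
    fix x y assume "occupancy N x = occupancy N y"
    from idle_cong[OF this] show "(idle x)\<^sup>2 * 1 = (idle y)\<^sup>2 * 1" by simp
  qed simp_all
  then show ?thesis by simp
qed

lemma E_idle_waiting_sq:
  "2 * \<mu> M * E (\<lambda>x. idle x * (waiting x)\<^sup>2)
    \<le> 2 * slack * E (\<lambda>x. idle x * waiting x) + (\<Lambda> + cap) * E waiting"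
proof -
  have "0 \<le> E (\<lambda>x. 2 * slack * (idle x * waiting x) + (\<Lambda> + cap) * waiting x
      - 2 * \<mu> M * (idle x * (waiting x)\<^sup>2))"
  proof (rule E_gen_le)
    fix x
    have "waiting x * idle x * (\<mu> M * waiting x) \<le> waiting x * idle x * occ \<mu> 2 x"
      using occ_\<mu>_lower[of 2 x] idle_nonneg[of x] waiting_nonneg[of x]
      by (intro mult_left_mono) (auto simp: waiting_def)
    moreover have "0 \<le> waiting x * idle x * idle_rate x"
      using idle_nonneg[of x] idle_rate_nonneg[of x] waiting_nonneg[of x] by simp
    ultimately show "gen (\<lambda>x. (idle x)\<^sup>2 * waiting x) x
        \<le> 2 * slack * (idle x * waiting x) + (\<Lambda> + cap) * waiting x - 2 * \<mu> M * (idle x * (waiting x)\<^sup>2)"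
      using gen_idle_sq[of "\<lambda>u. u" x] by (simp add: algebra_simps power2_eq_square)
  next
    fix x y assume "occupancy N x = occupancy N y"
    from idle_cong[OF this] waiting_cong[OF this]
    show "(idle x)\<^sup>2 * waiting x = (idle y)\<^sup>2 * waiting y" by simp
  qed simp_all
  then show ?thesis by simp
qed

text \<open>The third level disappears here: in expectation \<open>occ \<mu> 3\<close> and \<open>\<Lambda> * full 2\<close> agree by level balance, and
\<open>\<phi>'\<close> is at most its value at \<open>n\<close> in the first term and equal to it in the second.\<close>

lemma E_excess:
  assumes \<phi>: "\<And>r d. d \<in> {-1, 1} \<Longrightarrow> \<phi> (r + d) - \<phi> r \<le> \<phi>' r * d + h r"
    and h: "\<And>r. (0::real) \<le> h r"
    and top: "\<And>r. r \<le> real n \<Longrightarrow> \<phi>' r \<le> \<phi>' (real n)"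
    and bdd [simp]: "bounded_fun (\<lambda>x. \<phi> (excess x))" "bounded_fun (\<lambda>x. \<phi>' (excess x))"
      "bounded_fun (\<lambda>x. h (excess x))"
  shows "slack * E (\<lambda>x. \<phi>' (excess x))
    \<le> E (\<lambda>x. \<phi>' (excess x) * idle_rate x) + (\<Lambda> + cap) * E (\<lambda>x. h (excess x))"
proof -
  let ?K = "\<phi>' (real n)"
  have "0 \<le> E (\<lambda>x. \<phi>' (excess x) * idle_rate x - slack * \<phi>' (excess x)
      + ?K * (occ \<mu> 3 x - \<Lambda> * full 2 x) + (\<Lambda> + cap) * h (excess x))"
  proof (rule E_gen_le)
    fix x
    have "\<phi>' (excess x) * occ \<mu> 3 x \<le> ?K * occ \<mu> 3 x"
      using top[OF excess_le] occ_\<mu>_nonneg by (rule mult_right_mono)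
    moreover have "\<phi>' (excess x) * full 2 x = ?K * full 2 x"
      using excess_full_2[of x] by (auto simp: full_def of_bool_def split: if_splits)
    then have eq: "\<phi>' (excess x) * (\<Lambda> * full 2 x) = ?K * (\<Lambda> * full 2 x)"
      by (metis mult.left_commute)
    have "gen (\<lambda>x. \<phi> (excess x)) x \<le> \<phi>' (excess x) * idle_rate x - slack * \<phi>' (excess x)
        + \<phi>' (excess x) * occ \<mu> 3 x - \<phi>' (excess x) * (\<Lambda> * full 2 x) + (\<Lambda> + cap) * h (excess x)"
      using gen_excess[of \<phi> \<phi>' h x, OF \<phi> h] by (simp add: algebra_simps)
    ultimately show "gen (\<lambda>x. \<phi> (excess x)) x \<le> \<phi>' (excess x) * idle_rate x - slack * \<phi>' (excess x)
      + ?K * (occ \<mu> 3 x - \<Lambda> * full 2 x) + (\<Lambda> + cap) * h (excess x)"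
      unfolding eq right_diff_distrib[of ?K] by linarith
  next
    fix x y assume "occupancy N x = occupancy N y"
    from excess_cong[OF this] show "\<phi> (excess x) = \<phi> (excess y)" by simp
  qed simp_all
  then show ?thesis using level_balance[of 2] by simp
qed

lemma E_excess_linear: "slack * E excess \<le> \<mu> 1 * E (\<lambda>x. idle x * waiting x) + (\<Lambda> + cap) / 2"
proof -
  have "slack * E (\<lambda>x. 2 * excess x) \<le> E (\<lambda>x. 2 * excess x * idle_rate x) + (\<Lambda> + cap) * E (\<lambda>x. 1)"
    by (rule E_excess[where \<phi> = "\<lambda>r. r\<^sup>2"]) (auto simp: power2_eq_square algebra_simps)
  also have "E (\<lambda>x. 2 * excess x * idle_rate x) \<le> E (\<lambda>x. 2 * \<mu> 1 * (idle x * waiting x))"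
  proof (rule E_mono)
    fix x
    have "excess x * idle_rate x \<le> waiting x * (\<mu> 1 * idle x)"
      using excess_le_waiting[of x] idle_rate_bounds(2)[of x] waiting_nonneg[of x] idle_rate_nonneg[of x]
      by (intro mult_mono) auto
    then show "2 * excess x * idle_rate x \<le> 2 * \<mu> 1 * (idle x * waiting x)"
      by (simp add: algebra_simps)
  qed simp_all
  finally have "2 * (slack * E excess) \<le> 2 * (\<mu> 1 * E (\<lambda>x. idle x * waiting x)) + (\<Lambda> + cap)"
    by (simp add: mult.left_commute mult.assoc)
  then show ?thesis by (simp add: add_divide_distrib)
qed

lemma E_excess_sq:
  "slack * E (\<lambda>x. (max (excess x) 0)\<^sup>2)
    \<le> \<mu> 1 * E (\<lambda>x. idle x * (waiting x)\<^sup>2) + (\<Lambda> + cap) * (E waiting + 1)"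
proof -
  have "slack * E (\<lambda>x. 3 * (max (excess x) 0)\<^sup>2)
      \<le> E (\<lambda>x. 3 * (max (excess x) 0)\<^sup>2 * idle_rate x) + (\<Lambda> + cap) * E (\<lambda>x. 3 * max (excess x) 0 + 1)"
  proof (rule E_excess[where \<phi> = "\<lambda>r. (max r 0) ^ 3"])
    show "3 * (max r 0)\<^sup>2 \<le> 3 * (max (real n) 0)\<^sup>2" if "r \<le> real n" for r
      using that by (intro mult_left_mono power_mono) auto
  qed (use cube_pos_part_increment in auto)
  also have "E (\<lambda>x. 3 * (max (excess x) 0)\<^sup>2 * idle_rate x) \<le> E (\<lambda>x. 3 * \<mu> 1 * (idle x * (waiting x)\<^sup>2))"
  proof (rule E_mono)
    fix x
    have "(max (excess x) 0)\<^sup>2 * idle_rate x \<le> (waiting x)\<^sup>2 * (\<mu> 1 * idle x)"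
      using excess_le_waiting[of x] idle_rate_bounds(2)[of x] waiting_nonneg[of x] idle_rate_nonneg[of x]
      by (intro mult_mono power_mono) auto
    then show "3 * (max (excess x) 0)\<^sup>2 * idle_rate x \<le> 3 * \<mu> 1 * (idle x * (waiting x)\<^sup>2)"
      by (simp add: algebra_simps)
  qed simp_all
  also have "(\<Lambda> + cap) * E (\<lambda>x. 3 * max (excess x) 0 + 1) \<le> (\<Lambda> + cap) * E (\<lambda>x. 3 * (waiting x + 1))"
  proof (intro mult_left_mono E_mono)
    show "3 * max (excess x) 0 + 1 \<le> 3 * (waiting x + 1)" for x
      using excess_le_waiting[of x] waiting_nonneg[of x] by simp
    show "0 \<le> \<Lambda> + cap" using \<Lambda> cap_nonneg by simp
  qed simp_all
  also have "E (\<lambda>x. 3 * (waiting x + 1)) = 3 * (E waiting + 1)" by simp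
  finally have "3 * (slack * E (\<lambda>x. (max (excess x) 0)\<^sup>2))
      \<le> 3 * (\<mu> 1 * E (\<lambda>x. idle x * (waiting x)\<^sup>2)) + 3 * ((\<Lambda> + cap) * (E waiting + 1))"
    by (simp only: mult.left_commute[of slack] mult.left_commute[of "\<Lambda> + cap"] mult.assoc
        integral_mult_right_zero)
  then show ?thesis by linarith
qed

text \<open>Chebyshev's inequality.\<close>

lemma E_excess_tail:
  "(real (N 1))\<^sup>2 * E (\<lambda>x. of_bool (real (N 1) \<le> excess x)) \<le> E (\<lambda>x. (max (excess x) 0)\<^sup>2)"
proof -
  have "E (\<lambda>x. (real (N 1))\<^sup>2 * of_bool (real (N 1) \<le> excess x)) \<le> E (\<lambda>x. (max (excess x) 0)\<^sup>2)"
  proof (rule E_mono)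
    show "(real (N 1))\<^sup>2 * of_bool (real (N 1) \<le> excess x) \<le> (max (excess x) 0)\<^sup>2" for x
      by (cases "real (N 1) \<le> excess x") (auto intro!: power_mono)
  qed simp_all
  then show ?thesis by simp
qed

lemma E_third_level: "E (occ \<mu> 3) \<le> \<Lambda> * E (\<lambda>x. of_bool (real (N 1) \<le> excess x))"
  using level_balance[of 2] E_mono[of "full 2" "\<lambda>x. of_bool (real (N 1) \<le> excess x)", OF _ _ full_2_le] \<Lambda>
  by simp

text \<open>Servers of type at least 2 leave the second level when they have exactly two jobs; those with more are
accounted for by \<open>E_third_level\<close>, which brings in the factor 2.\<close>

lemma E_slow_waiting:
  "\<mu> M * E (occ (\<lambda>j. of_bool (2 \<le> j)) 2) \<le> 2 * \<Lambda> * E (\<lambda>x. of_bool (real (N 1) \<le> excess x))"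
proof -
  let ?v = "\<lambda>j. of_bool (2 \<le> j) :: real"
  let ?o = "occ (\<lambda>j. \<mu> j * ?v j)"
  have "0 \<le> E (\<lambda>x. \<Lambda> * of_bool (real (N 1) \<le> excess x) - (?o 2 x - ?o 3 x))"
    by (rule E_gen_le[OF _ occ_cong _ gen_slow_waiting]) simp_all
  then have "E (?o 2) \<le> \<Lambda> * E (\<lambda>x. of_bool (real (N 1) \<le> excess x)) + E (?o 3)" by simp
  also have "E (?o 3) \<le> E (occ \<mu> 3)"
  proof (rule E_mono)
    show "?o 3 x \<le> occ \<mu> 3 x" for x
      by (rule occ_mono) (use \<mu>_nonneg in \<open>simp_all add: of_bool_def\<close>)
  qed simp_all
  also note E_third_level
  also have "\<mu> M * E (occ ?v 2) \<le> E (?o 2)"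
  proof -
    have "E (\<lambda>x. \<mu> M * occ ?v 2 x) \<le> E (?o 2)"
    proof (rule E_mono)
      show "\<mu> M * occ ?v 2 x \<le> ?o 2 x" for x
        unfolding occ_def sum_distrib_left
        using speed_bounds(1) srv_type by (intro sum_mono) (auto simp: of_bool_def)
    qed simp_all
    then show ?thesis by simp
  qed
  ultimately show ?thesis by simp
qed

lemma E_fast_idle: "2 * (\<mu> M * real (N M) - slack) * E fast_idle \<le> \<Lambda> + cap"
proof -
  have "0 \<le> E (\<lambda>x. 2 * fast_idle x * (slack - \<mu> M * real (N M)) + (\<Lambda> + cap))"
    by (rule E_gen_le[OF _ arg_cong[where f = "\<lambda>u. u\<^sup>2", OF fast_idle_cong] _ gen_fast_idle_sq]) simp_all
  then show ?thesis by (simp add: algebra_simps)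
qed

text \<open>The moment inequalities chained together, with constants that depend on \<open>n\<close> only through the regularity
parameters \<open>A\<close>, \<open>\<alpha>\<close>, \<open>B\<close> and \<open>g\<close>.  They bound, in units of the appropriate power of \<open>\<surd>n\<close>: \<open>K1\<close> the mean of
\<open>idle * waiting\<close>, \<open>K2\<close> that of \<open>waiting\<close>, \<open>K3\<close> that of \<open>idle * waiting\<^sup>2\<close>, \<open>K4\<close> that of \<open>max excess 0\<close>
squared, and \<open>K5\<close> the rate of arrivals that find \<open>excess\<close> at least \<open>N 1\<close>.\<close>

lemma stationary_bounds:
  fixes A \<alpha> B g :: real
  defines "K1 \<equiv> (A\<^sup>2 / \<mu> M + B / 2) / \<mu> M"
  defines "K2 \<equiv> (\<mu> 1 * K1 + B / 2) / \<alpha> + A / \<mu> M"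
  defines "K3 \<equiv> (2 * A * K1 + B * K2) / (2 * \<mu> M)"
  defines "K4 \<equiv> (\<mu> 1 * K3 + B * (K2 + 1)) / \<alpha>"
  defines "K5 \<equiv> B * K4 / g\<^sup>2"
  assumes pos: "0 < \<alpha>" "0 < g"
    and slack: "\<alpha> * sqrt (real n) \<le> slack" "slack \<le> A * sqrt (real n)"
    and rate: "\<Lambda> + cap \<le> B * real n"
    and pools: "g * real n \<le> real (N 1)" "slack + g * real n \<le> \<mu> M * real (N M)"
  shows "E fast_idle \<le> B / (2 * g)"
    and "E idle \<le> A / \<mu> M * sqrt (real n)"
    and "E waiting \<le> K2 * sqrt (real n)"
    and "E (occ (\<lambda>_. 1) 3) \<le> K5 / \<mu> M"
    and "E (occ (\<lambda>j. of_bool (2 \<le> j)) 2) \<le> 2 * K5 / \<mu> M"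
proof -
  define s where "s = sqrt (real n)"
  define b where "b = \<Lambda> + cap"
  have s: "1 \<le> s" "real n = s\<^sup>2" using n by (auto simp: s_def)
  have b: "0 \<le> b" "b \<le> B * s\<^sup>2" using \<Lambda> cap_nonneg rate s by (auto simp: b_def)
  have B: "0 \<le> B"
    using order_trans[OF b] s by (simp add: zero_le_mult_iff)
  have m: "0 < \<mu> M" "0 < \<mu> 1" using slowest speed_bounds(3)[of 1] M by auto
  have slack': "\<alpha> * s \<le> slack" "slack \<le> A * s" "0 < slack"
    using slack[folded s_def] pos s(1) less_le_trans[of 0 "\<alpha> * s" slack] by auto
  have A: "0 \<le> A" using slack' s by (smt (verit) mult_nonneg_nonneg mult_neg_pos)
  \<comment> \<open>spare capacity of order \<open>s\<close> turns a bound on the drift into a bound one power of \<open>s\<close> lower\<close>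
  have div_slack: "u \<le> v / \<alpha> * t" if "slack * u \<le> v * (s * t)" "0 \<le> v" "0 \<le> t" for u v t
  proof (cases "u \<le> 0")
    case True
    then show ?thesis using that pos by (meson divide_nonneg_pos mult_nonneg_nonneg order_trans)
  next
    case False
    have "\<alpha> * s * u \<le> slack * u" using slack' False by (intro mult_right_mono) auto
    then have "s * (\<alpha> * u) \<le> s * (v * t)" using that(1) by (simp add: mult_ac)
    then have "\<alpha> * u \<le> v * t" using s by simp
    then show ?thesis using pos by (simp add: field_simps)
  qed
  have E_nonneg: "0 \<le> E f" if "\<And>x. 0 \<le> f x" for f
    by (rule Bochner_Integration.integral_nonneg) (rule that)
  have E0: "0 \<le> E idle" "0 \<le> E waiting" "0 \<le> E (\<lambda>x. idle x * waiting x)"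
      "0 \<le> E (\<lambda>x. idle x * (waiting x)\<^sup>2)"
    by (intro E_nonneg; simp add: idle_nonneg waiting_nonneg)+

  have fast: "2 * g * s\<^sup>2 * E fast_idle \<le> B * s\<^sup>2"
  proof -
    have "2 * g * s\<^sup>2 * E fast_idle \<le> 2 * (\<mu> M * real (N M) - slack) * E fast_idle"
      using pools(2) s by (intro mult_right_mono E_nonneg fast_idle_nonneg) auto
    then show ?thesis using E_fast_idle b(2) by (simp add: b_def)
  qed
  then show "E fast_idle \<le> B / (2 * g)"
    using s pos by (simp add: field_simps)

  have idle: "E idle \<le> A / \<mu> M * s"
    using E_idle slack'(2) m by (simp add: field_simps)
  then show "E idle \<le> A / \<mu> M * sqrt (real n)" by (simp add: s_def)

  have iw: "E (\<lambda>x. idle x * waiting x) \<le> K1 * s\<^sup>2"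
  proof -
    have "2 * \<mu> M * E (\<lambda>x. idle x * waiting x) \<le> 2 * slack * E idle + b"
      using E_idle_waiting by (simp add: b_def)
    also have "\<dots> \<le> 2 * (A * s) * (A / \<mu> M * s) + B * s\<^sup>2"
      using slack' idle b A m E0 s by (intro add_mono mult_mono) auto
    also have "\<dots> = 2 * \<mu> M * (K1 * s\<^sup>2)"
      using m by (simp add: K1_def field_simps power2_eq_square)
    finally show ?thesis using m by simp
  qed
  have K1: "0 \<le> K1" using m A B by (simp add: K1_def)

  have excess: "E excess \<le> (\<mu> 1 * K1 + B / 2) / \<alpha> * s"
  proof (rule div_slack)
    have "slack * E excess \<le> \<mu> 1 * E (\<lambda>x. idle x * waiting x) + b / 2"
      using E_excess_linear by (simp add: b_def)
    also have "\<dots> \<le> \<mu> 1 * (K1 * s\<^sup>2) + B * s\<^sup>2 / 2"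
      using iw b m by (intro add_mono mult_left_mono) auto
    finally show "slack * E excess \<le> (\<mu> 1 * K1 + B / 2) * (s * s)"
      by (simp add: algebra_simps power2_eq_square)
  qed (use m K1 B s in auto)
  have waiting: "E waiting \<le> K2 * s"
  proof -
    have "E waiting = E excess + E idle" by (simp add: excess_def[abs_def])
    then show ?thesis using excess idle by (simp add: K2_def algebra_simps)
  qed
  then show "E waiting \<le> K2 * sqrt (real n)" by (simp add: s_def)
  have K2: "0 \<le> K2" using m K1 A B pos by (simp add: K2_def)

  have iww: "E (\<lambda>x. idle x * (waiting x)\<^sup>2) \<le> K3 * s ^ 3"
  proof -
    have "2 * \<mu> M * E (\<lambda>x. idle x * (waiting x)\<^sup>2)
        \<le> 2 * slack * E (\<lambda>x. idle x * waiting x) + b * E waiting"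
      using E_idle_waiting_sq by (simp add: b_def)
    also have "\<dots> \<le> 2 * (A * s) * (K1 * s\<^sup>2) + B * s\<^sup>2 * (K2 * s)"
      using slack' iw waiting b A B E0 s by (intro add_mono mult_mono) auto
    also have "\<dots> = 2 * \<mu> M * (K3 * s ^ 3)"
      using m by (simp add: K3_def field_simps power2_eq_square power3_eq_cube)
    finally show ?thesis using m by simp
  qed
  have K3: "0 \<le> K3" using m A B K1 K2 by (simp add: K3_def)

  have sq: "E (\<lambda>x. (max (excess x) 0)\<^sup>2) \<le> K4 * s\<^sup>2"
    unfolding K4_def
  proof (rule div_slack)
    have "slack * E (\<lambda>x. (max (excess x) 0)\<^sup>2)
        \<le> \<mu> 1 * E (\<lambda>x. idle x * (waiting x)\<^sup>2) + b * (E waiting + 1)"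
      using E_excess_sq by (simp add: b_def)
    also have "\<dots> \<le> \<mu> 1 * (K3 * s ^ 3) + B * s\<^sup>2 * (K2 * s + s)"
      using iww waiting b m B E0 s by (intro add_mono mult_mono) auto
    finally show "slack * E (\<lambda>x. (max (excess x) 0)\<^sup>2) \<le> (\<mu> 1 * K3 + B * (K2 + 1)) * (s * s\<^sup>2)"
      by (simp add: algebra_simps power2_eq_square power3_eq_cube)
  qed (use m K3 B K2 s in auto)
  have K4: "0 \<le> K4" using m K3 K2 B pos by (simp add: K4_def)

  let ?p = "E (\<lambda>x. of_bool (real (N 1) \<le> excess x))"
  have p: "0 \<le> ?p" by (rule E_nonneg) simp
  have tail: "\<Lambda> * ?p \<le> K5"
  proof -
    have "(g * s\<^sup>2)\<^sup>2 * ?p \<le> (real (N 1))\<^sup>2 * ?p"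
      using pools(1) pos s p by (intro mult_right_mono power_mono) auto
    also have "\<dots> \<le> K4 * s\<^sup>2" using E_excess_tail sq by simp
    finally have "s\<^sup>2 * (g\<^sup>2 * (s\<^sup>2 * ?p)) \<le> s\<^sup>2 * K4"
      by (simp add: power_mult_distrib power2_eq_square mult_ac)
    then have "g\<^sup>2 * (s\<^sup>2 * ?p) \<le> K4"
      by (rule mult_left_le_imp_le) (use s in auto)
    then have "s\<^sup>2 * ?p \<le> K4 / g\<^sup>2" using pos by (simp add: field_simps)
    then have "B * (s\<^sup>2 * ?p) \<le> B * (K4 / g\<^sup>2)" using B by (rule mult_left_mono)
    moreover have "\<Lambda> * ?p \<le> B * s\<^sup>2 * ?p"
      using b cap_nonneg p by (intro mult_right_mono) (auto simp: b_def)
    ultimately show ?thesis by (simp add: K5_def mult_ac)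
  qed
  show "E (occ (\<lambda>_. 1) 3) \<le> K5 / \<mu> M"
  proof -
    have "\<mu> M * E (occ (\<lambda>_. 1) 3) \<le> E (occ \<mu> 3)"
      using E_mono[of "\<lambda>x. \<mu> M * occ (\<lambda>_. 1) 3 x" "occ \<mu> 3"] occ_\<mu>_lower by simp
    then have "\<mu> M * E (occ (\<lambda>_. 1) 3) \<le> K5"
      using E_third_level tail by simp
    then show ?thesis using m by (simp add: field_simps)
  qed
  show "E (occ (\<lambda>j. of_bool (2 \<le> j)) 2) \<le> 2 * K5 / \<mu> M"
    using E_slow_waiting tail m by (simp add: field_simps)
qed

lemma E_scaled_le:
  assumes "\<And>x. \<bar>scaled n N x j i\<bar> \<le> F x / sqrt (real n)" and "bounded_fun F" and "E F \<le> K"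
  shows "measure_pmf.expectation (map_pmf (scaled n N) p) (\<lambda>y. \<bar>y j i\<bar>) \<le> K / sqrt (real n)"
proof -
  have F: "bounded_fun (\<lambda>x. F x / sqrt (real n))"
    using bounded_fun_mult[OF assms(2) bounded_fun_const[of "1 / sqrt (real n)"]] by simp
  obtain b where "\<And>x. \<bar>F x / sqrt (real n)\<bar> \<le> b" using F by (auto simp: bounded_fun_def)
  then have "bounded_fun (\<lambda>x. \<bar>scaled n N x j i\<bar>)"
    using assms(1) by (intro bounded_funI[of _ b]) (metis abs_idempotent abs_ge_self order_trans)
  then have "E (\<lambda>x. \<bar>scaled n N x j i\<bar>) \<le> E (\<lambda>x. F x / sqrt (real n))"
    using F assms(1) by (rule E_mono)
  also have "\<dots> \<le> K / sqrt (real n)" using assms(3) by (simp add: divide_right_mono)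
  finally show ?thesis by simp
qed

end

lemma stationary_dist_Y_stationary:
  assumes "sa_jsq M \<mu> N n (real n * l)" and "stationary_dist_Y n M \<mu> N l \<eta>"
  obtains P p where "sa_jsq_stationary M \<mu> N n (real n * l) P p" "\<eta> = map_pmf (scaled n N) p"
proof -
  obtain P p where P: "ctmc_transition (sa_jsq_generator M \<mu> N (real n * l)) P"
    and inv: "\<And>t. 0 \<le> t \<Longrightarrow> map_pmf (scaled n N) (bind_pmf p (P t)) = \<eta>"
    using assms(2) by (auto simp: stationary_dist_Y_def)
  have "P 0 = return_pmf" using P by (auto simp: ctmc_transition_def)
  then have \<eta>: "\<eta> = map_pmf (scaled n N) p" using inv[of 0] by (simp add: bind_return_pmf')
  have "sa_jsq_stationary M \<mu> N n (real n * l) P p"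
    using assms(1) P inv by (auto simp: sa_jsq_stationary_def sa_jsq_stationary_axioms_def \<eta>)
  then show ?thesis using \<eta> by (rule that)
qed

section \<open>Heavy traffic\<close>

theorem theorem3p3:
  fixes M :: nat and \<mu> \<gamma> :: "nat \<Rightarrow> real" and N :: "nat \<Rightarrow> nat \<Rightarrow> nat"
    and lam :: "nat \<Rightarrow> real" and \<beta> :: real
  assumes "M \<ge> 2"
    and "\<And>i j. 1 \<le> i \<Longrightarrow> i < j \<Longrightarrow> j \<le> M \<Longrightarrow> \<mu> j < \<mu> i"
    and "\<mu> M > 0"
    and "\<And>j. j \<in> {1..M} \<Longrightarrow> \<gamma> j > 0"
    and "(\<Sum>j=1..M. \<mu> j * \<gamma> j) = 1"
    and "\<And>n. n \<ge> 1 \<Longrightarrow> (\<Sum>j=1..M. N n j) = n"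
    and "\<And>n. n \<ge> 1 \<Longrightarrow> 0 < lam n \<and> lam n < 1"
    and "\<beta> > 0"
    and "(\<lambda>n. sqrt (real n) * (1 - lam n)) \<longlonglongrightarrow> \<beta>"
    and "\<And>j. j \<in> {1..M} \<Longrightarrow>
           (\<lambda>n. sqrt (real n) * \<bar>real (N n j) / real n - \<gamma> j\<bar>) \<longlonglongrightarrow> 0"
  shows "(\<exists>C\<^sub>1 C\<^sub>2 C\<^sub>3 :: real. C\<^sub>1 > 0 \<and> C\<^sub>2 > 0 \<and> C\<^sub>3 > 0 \<and>
            (\<forall>\<^sub>F n in sequentially. \<forall>\<eta>. stationary_dist_Y n M \<mu> (N n) (lam n) \<eta> \<longrightarrow>
               (\<forall>j. 1 \<le> j \<and> j \<le> M - 1 \<longrightarrow>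
                  measure_pmf.expectation \<eta> (\<lambda>y. \<bar>y j 1\<bar>) < C\<^sub>1 * real n powr (- 1 / 2)) \<and>
               measure_pmf.expectation \<eta> (\<lambda>y. \<bar>y M 1\<bar>) \<le> C\<^sub>2 \<and>
               measure_pmf.expectation \<eta> (\<lambda>y. \<bar>y 1 2\<bar>) \<le> C\<^sub>3)) \<and>
         (\<forall>a::real. 1 / 2 < a \<and> a < 1 \<longrightarrow>
            (\<exists>C\<^sub>4 :: real. \<forall>\<^sub>F n in sequentially. \<forall>\<eta>. stationary_dist_Y n M \<mu> (N n) (lam n) \<eta> \<longrightarrow>
               (\<forall>j i. (2 \<le> j \<and> j \<le> M \<and> i = 2) \<or> (1 \<le> j \<and> j \<le> M \<and> 3 \<le> i) \<longrightarrow>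
                  measure_pmf.expectation \<eta> (\<lambda>y. \<bar>y j i\<bar>) \<le> C\<^sub>4 * real n powr (- (a - 1 / 2)))))"
proof -
  define S where "S n = (\<Sum>j=1..M. \<mu> j * real (N n j)) - real n * lam n" for n
  have pool: "(\<lambda>n. real (N n j) / real n) \<longlonglongrightarrow> \<gamma> j" if j: "j \<in> {1..M}" for j
  proof (rule LIM_zero_cancel, rule Lim_null_comparison[OF _ assms(10)[OF j]])
    show "\<forall>\<^sub>F n in sequentially. norm (real (N n j) / real n - \<gamma> j)
        \<le> sqrt (real n) * \<bar>real (N n j) / real n - \<gamma> j\<bar>"
      using eventually_ge_at_top[of 1]
    proof eventually_elim
      case (elim n)
      then have "1 * \<bar>real (N n j) / real n - \<gamma> j\<bar> \<le> sqrt (real n) * \<bar>real (N n j) / real n - \<gamma> j\<bar>"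
        by (intro mult_right_mono) auto
      then show ?case by simp
    qed
  qed
  \<comment> \<open>\<open>S n\<close> is the spare capacity; the normalisation \<open>\<Sum>j. \<mu>\<^sub>j \<gamma>\<^sub>j = 1\<close> cancels its terms of order \<open>n\<close>\<close>
  have S_sqrt: "(\<lambda>n. S n / sqrt (real n)) \<longlonglongrightarrow> \<beta>"
  proof -
    have "(\<lambda>n. (\<Sum>j=1..M. \<mu> j * (sqrt (real n) * (real (N n j) / real n - \<gamma> j)))
        + sqrt (real n) * (1 - lam n)) \<longlonglongrightarrow> (\<Sum>j=1..M. \<mu> j * 0) + \<beta>"
    proof (intro tendsto_add tendsto_sum tendsto_mult[OF tendsto_const] assms(9))
      fix j assume "j \<in> {1..M}"
      then show "(\<lambda>n. sqrt (real n) * (real (N n j) / real n - \<gamma> j)) \<longlonglongrightarrow> 0"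
        using assms(10) by (intro tendsto_rabs_zero_cancel[OF tendsto_cong[THEN iffD1, OF always_eventually assms(10)]])
          (auto simp: abs_mult)
    qed
    moreover have "\<forall>\<^sub>F n in sequentially. (\<Sum>j=1..M. \<mu> j * (sqrt (real n) * (real (N n j) / real n - \<gamma> j)))
        + sqrt (real n) * (1 - lam n) = S n / sqrt (real n)"
      using eventually_ge_at_top[of 1]
    proof eventually_elim
      case (elim n)
      then have sq: "sqrt (real n) * u / real n = u / sqrt (real n)" "real n * u / sqrt (real n) = sqrt (real n) * u" for u
        by (simp_all add: field_simps)
      have "(\<Sum>j=1..M. \<mu> j * (sqrt (real n) * (real (N n j) / real n - \<gamma> j)))
          = (\<Sum>j=1..M. \<mu> j * real (N n j) / sqrt (real n) - sqrt (real n) * (\<mu> j * \<gamma> j))"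
        by (intro sum.cong refl) (use sq(1)[of "real (N n j)" for j] in \<open>simp add: algebra_simps\<close>)
      also have "\<dots> = (\<Sum>j=1..M. \<mu> j * real (N n j)) / sqrt (real n) - sqrt (real n)"
        using assms(5) by (simp add: sum_subtractf flip: sum_divide_distrib sum_distrib_left)
      finally show ?case
        using sq(2)[of "lam n"] by (simp add: S_def algebra_simps diff_divide_distrib)
    qed
    ultimately show ?thesis by (auto intro: Lim_transform_eventually)
  qed
  have S_n: "(\<lambda>n. S n / real n) \<longlonglongrightarrow> 0"
  proof -
    have "(\<lambda>n. 1 / sqrt (real n)) \<longlonglongrightarrow> 0" by real_asymp
    from tendsto_mult[OF S_sqrt this] have "(\<lambda>n. S n / (sqrt (real n) * sqrt (real n))) \<longlonglongrightarrow> 0"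
      by simp
    then show ?thesis by simp
  qed

  define A where "A = 2 * \<beta>"
  define \<alpha> where "\<alpha> = \<beta> / 2"
  define B where "B = 1 + \<mu> 1"
  define g where "g = min (\<gamma> 1 / 2) (\<mu> M * \<gamma> M / 2)"
  have \<gamma>: "0 < \<gamma> 1" "0 < \<mu> M * \<gamma> M" using assms(1,3,4) by auto
  have pos: "0 < \<alpha>" "0 < g" using assms(8) \<gamma> by (auto simp: \<alpha>_def g_def)
  have g_less: "g < \<gamma> 1" "g < \<mu> M * \<gamma> M" unfolding g_def using \<gamma> by linarith+
  have "\<forall>\<^sub>F n in sequentially. \<alpha> < S n / sqrt (real n)"
    by (rule order_tendstoD(1)[OF S_sqrt]) (use assms(8) in \<open>simp add: \<alpha>_def\<close>)
  moreover have "\<forall>\<^sub>F n in sequentially. S n / sqrt (real n) < A"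
    by (rule order_tendstoD(2)[OF S_sqrt]) (use assms(8) in \<open>simp add: A_def\<close>)
  moreover have "\<forall>\<^sub>F n in sequentially. g < real (N n 1) / real n"
    by (rule order_tendstoD(1)[OF pool]) (use assms(1) g_less in auto)
  moreover have "\<forall>\<^sub>F n in sequentially. g < \<mu> M * (real (N n M) / real n) - S n / real n"
  proof (rule order_tendstoD(1))
    show "(\<lambda>n. \<mu> M * (real (N n M) / real n) - S n / real n) \<longlonglongrightarrow> \<mu> M * \<gamma> M - 0"
      by (intro tendsto_diff tendsto_mult tendsto_const S_n pool) (use assms(1) in auto)
  qed (use g_less in simp)
  ultimately have regular: "\<forall>\<^sub>F n in sequentially. 1 \<le> n \<and> \<alpha> * sqrt (real n) \<le> S n
      \<and> S n \<le> A * sqrt (real n) \<and> g * real n \<le> real (N n 1) \<and> S n + g * real n \<le> \<mu> M * real (N n M)"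
    using eventually_ge_at_top[of 1]
    by eventually_elim (auto simp: field_simps)

  define K1 where "K1 = (A\<^sup>2 / \<mu> M + B / 2) / \<mu> M"
  define K2 where "K2 = (\<mu> 1 * K1 + B / 2) / \<alpha> + A / \<mu> M"
  define K3 where "K3 = (2 * A * K1 + B * K2) / (2 * \<mu> M)"
  define K4 where "K4 = (\<mu> 1 * K3 + B * (K2 + 1)) / \<alpha>"
  define K5 where "K5 = B * K4 / g\<^sup>2"
  \<comment> \<open>one constant that dominates all bounds of \<open>stationary_bounds\<close>\<close>
  define K where "K = 1 + \<bar>B / (2 * g)\<bar> + \<bar>A / \<mu> M\<bar> + \<bar>K2\<bar> + 2 * \<bar>K5 / \<mu> M\<bar>"
  have K: "0 < K" "B / (2 * g) \<le> K" "A / \<mu> M \<le> K" "K2 \<le> K" "K5 / \<mu> M \<le> K" "2 * K5 / \<mu> M \<le> K"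
    unfolding K_def by linarith+

  have main: "\<forall>\<^sub>F n in sequentially. 1 \<le> n \<and> (\<forall>\<eta>. stationary_dist_Y n M \<mu> (N n) (lam n) \<eta> \<longrightarrow>
      (\<forall>j. 1 \<le> j \<and> j \<le> M - 1 \<longrightarrow>
         measure_pmf.expectation \<eta> (\<lambda>y. \<bar>y j 1\<bar>) \<le> K / sqrt (real n)) \<and>
      measure_pmf.expectation \<eta> (\<lambda>y. \<bar>y M 1\<bar>) \<le> K \<and>
      measure_pmf.expectation \<eta> (\<lambda>y. \<bar>y 1 2\<bar>) \<le> K \<and>
      (\<forall>j i. (2 \<le> j \<and> j \<le> M \<and> i = 2) \<or> (1 \<le> j \<and> j \<le> M \<and> 3 \<le> i) \<longrightarrow>
         measure_pmf.expectation \<eta> (\<lambda>y. \<bar>y j i\<bar>) \<le> K / sqrt (real n)))"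
    using regular
  proof eventually_elim
    case (elim n)
    then have n: "1 \<le> n"
      and regular: "\<alpha> * sqrt (real n) \<le> S n" "S n \<le> A * sqrt (real n)"
        "g * real n \<le> real (N n 1)" "S n + g * real n \<le> \<mu> M * real (N n M)"
      by simp_all
    have sys: "sa_jsq M \<mu> (N n) n (real n * lam n)"
      using assms(1,2,3) assms(6)[OF n] assms(7)[OF n] n by (simp add: sa_jsq_def)
    show ?case
    proof (intro conjI allI impI n)
      fix \<eta> assume "stationary_dist_Y n M \<mu> (N n) (lam n) \<eta>"
      then obtain P p where stat: "sa_jsq_stationary M \<mu> (N n) n (real n * lam n) P p"
        and \<eta>: "\<eta> = map_pmf (scaled n (N n)) p"
        by (rule stationary_dist_Y_stationary[OF sys])
      interpret sa_jsq_stationary M \<mu> "N n" n "real n * lam n" P p by (rule stat)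
      have cap: "cap = (\<Sum>j=1..M. \<mu> j * real (N n j))"
        unfolding cap_def by (rule sum_srv)
      then have slack: "slack = S n" by (simp add: slack_def S_def)
      have rate: "real n * lam n + cap \<le> B * real n"
      proof -
        have "cap \<le> (\<Sum>j=1..M. \<mu> 1 * real (N n j))"
          unfolding cap using speed_bounds(2) by (intro sum_mono mult_right_mono) auto
        also have "\<dots> = \<mu> 1 * real n"
          using assms(6)[OF n] by (simp flip: sum_distrib_left of_nat_sum)
        finally show ?thesis
          using assms(7)[OF n] mult_left_mono[of "lam n" 1 "real n"] by (simp add: B_def algebra_simps)
      qed
      note bounds = stationary_bounds[of \<alpha> g A B, folded K1_def, folded K2_def, folded K3_def,
          folded K4_def, folded K5_def, OF pos,
          unfolded slack, OF regular(1,2) rate regular(3,4)]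
      have fast: "E fast_idle \<le> K" and third: "E (occ (\<lambda>_. 1) 3) \<le> K"
        and slow: "E (occ (\<lambda>j. of_bool (2 \<le> j)) 2) \<le> K"
        using order_trans[OF bounds(1) K(2)] order_trans[OF bounds(4) K(5)] order_trans[OF bounds(5) K(6)]
        by simp_all
      have "A / \<mu> M * sqrt (real n) \<le> K * sqrt (real n)" "K2 * sqrt (real n) \<le> K * sqrt (real n)"
        using mult_right_mono[OF K(3), of "sqrt (real n)"] mult_right_mono[OF K(4), of "sqrt (real n)"]
        by simp_all
      then have idle: "E idle \<le> K * sqrt (real n)" and waiting: "E waiting \<le> K * sqrt (real n)"
        using bounds(2,3) by linarith+
      show "measure_pmf.expectation \<eta> (\<lambda>y. \<bar>y j 1\<bar>) \<le> K / sqrt (real n)"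
        if "1 \<le> j \<and> j \<le> M - 1" for j
        unfolding \<eta> by (rule E_scaled_le[OF scaled_bounds(1) _ fast]) (use that M in auto)
      show "measure_pmf.expectation \<eta> (\<lambda>y. \<bar>y M 1\<bar>) \<le> K"
        using E_scaled_le[OF scaled_bounds(2) _ idle, of M] M n by (simp add: \<eta>)
      show "measure_pmf.expectation \<eta> (\<lambda>y. \<bar>y 1 2\<bar>) \<le> K"
        using E_scaled_le[OF scaled_bounds(3) _ waiting, of 1] M n by (simp add: \<eta>)
      show "measure_pmf.expectation \<eta> (\<lambda>y. \<bar>y j i\<bar>) \<le> K / sqrt (real n)"
        if "2 \<le> j \<and> j \<le> M \<and> i = 2 \<or> 1 \<le> j \<and> j \<le> M \<and> 3 \<le> i" for j i
        using that
      proof (elim disjE conjE)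
        assume j: "2 \<le> j" "j \<le> M" "i = 2"
        show ?thesis
          unfolding \<eta> j(3) by (rule E_scaled_le[OF scaled_bounds(4) _ slow]) (use j in auto)
      next
        assume j: "1 \<le> j" "j \<le> M" "3 \<le> i"
        show ?thesis
          unfolding \<eta> by (rule E_scaled_le[OF scaled_bounds(5) _ third]) (use j in auto)
      qed
    qed
  qed
  have sqrt_powr: "1 / sqrt (real n) = real n powr (- 1 / 2)" if "1 \<le> n" for n :: nat
    using powr_minus[of "real n" "1 / 2"] powr_half_sqrt[of "real n"] by (simp add: inverse_eq_divide)
  show ?thesis
  proof (intro conjI allI impI)
    \<comment> \<open>the strict inequality requires a constant larger than \<open>K\<close>\<close>
    have "\<forall>\<^sub>F n in sequentially. \<forall>\<eta>. stationary_dist_Y n M \<mu> (N n) (lam n) \<eta> \<longrightarrow>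
               (\<forall>j. 1 \<le> j \<and> j \<le> M - 1 \<longrightarrow>
                  measure_pmf.expectation \<eta> (\<lambda>y. \<bar>y j 1\<bar>) < (K + 1) * real n powr (- 1 / 2)) \<and>
               measure_pmf.expectation \<eta> (\<lambda>y. \<bar>y M 1\<bar>) \<le> K \<and>
               measure_pmf.expectation \<eta> (\<lambda>y. \<bar>y 1 2\<bar>) \<le> K"
      using main
    proof eventually_elim
      case (elim n)
      then have n: "1 \<le> n" by simp
      then have "K / sqrt (real n) < (K + 1) * (1 / sqrt (real n))"
        by (simp add: divide_strict_right_mono)
      then have "K / sqrt (real n) < (K + 1) * real n powr (- 1 / 2)"
        unfolding sqrt_powr[OF n] .
      then show ?case using elim by (meson le_less_trans)
    qed
    then show "\<exists>C\<^sub>1 C\<^sub>2 C\<^sub>3 :: real. C\<^sub>1 > 0 \<and> C\<^sub>2 > 0 \<and> C\<^sub>3 > 0 \<and>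
            (\<forall>\<^sub>F n in sequentially. \<forall>\<eta>. stationary_dist_Y n M \<mu> (N n) (lam n) \<eta> \<longrightarrow>
               (\<forall>j. 1 \<le> j \<and> j \<le> M - 1 \<longrightarrow>
                  measure_pmf.expectation \<eta> (\<lambda>y. \<bar>y j 1\<bar>) < C\<^sub>1 * real n powr (- 1 / 2)) \<and>
               measure_pmf.expectation \<eta> (\<lambda>y. \<bar>y M 1\<bar>) \<le> C\<^sub>2 \<and>
               measure_pmf.expectation \<eta> (\<lambda>y. \<bar>y 1 2\<bar>) \<le> C\<^sub>3)"
      using K(1) by (intro exI[of _ "K + 1"] exI[of _ K] conjI) auto
  next
    fix a :: real assume a: "1 / 2 < a \<and> a < 1"
    have "\<forall>\<^sub>F n in sequentially. \<forall>\<eta>. stationary_dist_Y n M \<mu> (N n) (lam n) \<eta> \<longrightarrow>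
               (\<forall>j i. (2 \<le> j \<and> j \<le> M \<and> i = 2) \<or> (1 \<le> j \<and> j \<le> M \<and> 3 \<le> i) \<longrightarrow>
                  measure_pmf.expectation \<eta> (\<lambda>y. \<bar>y j i\<bar>) \<le> K * real n powr (- (a - 1 / 2)))"
      using main
    proof eventually_elim
      case (elim n)
      then have n: "1 \<le> n" by simp
      have "K / sqrt (real n) = K * (1 / sqrt (real n))" by simp
      also have "\<dots> = K * real n powr (- 1 / 2)"
        unfolding sqrt_powr[OF n] ..
      also have "\<dots> \<le> K * real n powr (- (a - 1 / 2))"
        using elim a K(1) by (intro mult_left_mono powr_mono) auto
      finally have le: "K / sqrt (real n) \<le> K * real n powr (- (a - 1 / 2))" .
      show ?case
      proof (intro allI impI)
        fix \<eta> and j i :: nat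
        assume "stationary_dist_Y n M \<mu> (N n) (lam n) \<eta>"
          and "(2 \<le> j \<and> j \<le> M \<and> i = 2) \<or> (1 \<le> j \<and> j \<le> M \<and> 3 \<le> i)"
        then have "measure_pmf.expectation \<eta> (\<lambda>y. \<bar>y j i\<bar>) \<le> K / sqrt (real n)"
          using elim by blast
        then show "measure_pmf.expectation \<eta> (\<lambda>y. \<bar>y j i\<bar>) \<le> K * real n powr (- (a - 1 / 2))"
          using le by (rule order_trans)
      qed
    qed
    then show "\<exists>C\<^sub>4 :: real. \<forall>\<^sub>F n in sequentially. \<forall>\<eta>. stationary_dist_Y n M \<mu> (N n) (lam n) \<eta> \<longrightarrow>
               (\<forall>j i. (2 \<le> j \<and> j \<le> M \<and> i = 2) \<or> (1 \<le> j \<and> j \<le> M \<and> 3 \<le> i) \<longrightarrow>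
                  measure_pmf.expectation \<eta> (\<lambda>y. \<bar>y j i\<bar>) \<le> C\<^sub>4 * real n powr (- (a - 1 / 2)))"
      by (rule exI)
  qed
qed

end
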